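(* Let $\beta'\in(0,1)$, $\sigma=1-\frac{\beta'}{2}$, $r\ge1$, $T>0$, and let the temporal meshes be quasi-graded with grading $r$ (see context). Let $\mu\in(0,1)\cup(1,2)$ and let $v\in C([0,T])\cap C^3((0,T])$ satisfy, for $l=0,1,2,3$ and all $t\in(0,T]$, $\left|\frac{\partial^lv(t)}{\partial t^l}\right|\le C(1+t^{\mu-l})$. Then for $n=1,2,\dots,N$, $$\left|D_t^{\beta'}v(t_n^* )-\delta_t^{\beta',*}v^n\right|\le C\,\tau_1^{\mu-\beta'}(\tau_1/t_n)^{\min\{1+\beta',\ \frac{3-\beta'}{r}-\mu+\beta'\}},$$ where $v^n=v(t_n)$ and the constant $C$ in the conclusion is independent of $n$ and of the mesh sizes (of $N$).
   Context: For each $N$ let $0=t_0<t_1<\dots<t_N=T$ and $\tau_n=t_n-t_{n-1}$. The meshes are quasi-graded: $\tau_1\simeq N^{-r}$, $t_n\simeq\tau_1n^r$, $\tau_n\simeq\tau_1^{1/r}t_n^{1-1/r}$ for $1\le n\le N$, where $a\simeq b$ means that $a/b$ is bounded above and below by positive constants independent of $n$ and $N$. Put $t_n^*=t_n-(1-\sigma)\tau_n$. Caputo derivative of order $\beta'\in(0,1)$: $D_t^{\beta'}v(t)=\frac1{\Gamma(1-\beta')}\int_0^t(t-s)^{-\beta'}v'(s)\,ds$. Alikhanov discrete derivative: $\delta_t^{\beta',*}v^n=\frac1{\Gamma(1-\beta')}\Bigl[\sum_{k=1}^{n-1}\int_{t_{k-1}}^{t_k}(t_n^*-s)^{-\beta'}\partial_s\Pi_{2,k}v(s)\,ds+\int_{t_{n-1}}^{t_n^*}(t_n^*-s)^{-\beta'}\partial_s\Pi_{1,n}v(s)\,ds\Bigr]$,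 where $\Pi_{2,k}v$ is the quadratic interpolant of $v$ at $t_{k-1},t_k,t_{k+1}$ and $\Pi_{1,n}v$ is the linear interpolant of $v$ at $t_{n-1},t_n$. *)

theory Defs
  imports "HOL-Analysis.Analysis"
begin

text \<open>
  A mesh is given by its nodes \<open>x :: nat \<Rightarrow> real\<close>, of which only \<open>x 0, \<dots>, x N\<close> matter.  A family of
  meshes \<open>t\<close> has \<open>t N\<close> as its member with \<open>N\<close> subintervals.
\<close>

definition mesh :: "real \<Rightarrow> nat \<Rightarrow> (nat \<Rightarrow> real) \<Rightarrow> bool" where
  "mesh T N x \<longleftrightarrow> x 0 = 0 \<and> x N = T \<and> (\<forall>n<N. x n < x (Suc n))"

definition step :: "(nat \<Rightarrow> real) \<Rightarrow> nat \<Rightarrow> real" where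
  "step x n = x n - x (n - 1)"

definition tstar :: "real \<Rightarrow> (nat \<Rightarrow> real) \<Rightarrow> nat \<Rightarrow> real" where
  "tstar \<sigma> x n = x n - (1 - \<sigma>) * step x n"

definition comparable_on :: "'i set \<Rightarrow> ('i \<Rightarrow> real) \<Rightarrow> ('i \<Rightarrow> real) \<Rightarrow> bool" where
  "comparable_on I a b \<longleftrightarrow> (\<exists>c>0. \<exists>C>0. \<forall>i\<in>I. c \<le> a i / b i \<and> a i / b i \<le> C)"

definition quasi_graded :: "real \<Rightarrow> (nat \<Rightarrow> nat \<Rightarrow> real) \<Rightarrow> bool" where
  "quasi_graded r t \<longleftrightarrow>
     comparable_on {1..} (\<lambda>N. step (t N) 1) (\<lambda>N. real N powr (- r)) \<and>
     comparable_on {(N, n). 1 \<le> n \<and> n \<le> N}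
       (\<lambda>(N, n). t N n) (\<lambda>(N, n). step (t N) 1 * real n powr r) \<and>
     comparable_on {(N, n). 1 \<le> n \<and> n \<le> N}
       (\<lambda>(N, n). step (t N) n)
       (\<lambda>(N, n). step (t N) 1 powr (1 / r) * t N n powr (1 - 1 / r))"

text \<open>
  Derivatives relative to a set, so that at the right end point of \<open>{0<..T}\<close> they are one-sided.
\<close>

primrec deriv_within :: "nat \<Rightarrow> (real \<Rightarrow> real) \<Rightarrow> real set \<Rightarrow> real \<Rightarrow> real" where
  "deriv_within 0 f S = f"
| "deriv_within (Suc l) f S = (\<lambda>x. vector_derivative (deriv_within l f S) (at x within S))"

definition Ck_on :: "nat \<Rightarrow> (real \<Rightarrow> real) \<Rightarrow> real set \<Rightarrow> bool" where
  "Ck_on k f S \<longleftrightarrow>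
     (\<forall>l<k. deriv_within l f S differentiable_on S) \<and> continuous_on S (deriv_within k f S)"

text \<open>
  The two-sided derivative below may be meaningless at \<open>s = 0\<close>, and also at \<open>s = t\<close> when \<open>t\<close> is the
  right end of the domain of \<open>v\<close>; these points do not affect the integral.
\<close>

definition caputo :: "real \<Rightarrow> (real \<Rightarrow> real) \<Rightarrow> real \<Rightarrow> real" where
  "caputo \<beta> v t =
     1 / Gamma (1 - \<beta>) * integral {0..t} (\<lambda>s. (t - s) powr (- \<beta>) * deriv v s)"

definition lin_interp :: "(real \<Rightarrow> real) \<Rightarrow> real \<Rightarrow> real \<Rightarrow> real \<Rightarrow> real" where
  "lin_interp v a b s = v a * ((s - b) / (a - b)) + v b * ((s - a) / (b - a))"

definition quad_interp :: "(real \<Rightarrow> real) \<Rightarrow> real \<Rightarrow> real \<Rightarrow> real \<Rightarrow> real \<Rightarrow> real" where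
  "quad_interp v a b c s =
     v a * ((s - b) * (s - c) / ((a - b) * (a - c))) +
     v b * ((s - a) * (s - c) / ((b - a) * (b - c))) +
     v c * ((s - a) * (s - b) / ((c - a) * (c - b)))"

definition alikhanov :: "real \<Rightarrow> real \<Rightarrow> (nat \<Rightarrow> real) \<Rightarrow> (real \<Rightarrow> real) \<Rightarrow> nat \<Rightarrow> real" where
  "alikhanov \<beta> \<sigma> x v n =
     1 / Gamma (1 - \<beta>) *
       ((\<Sum>k = 1..<n. integral {x (k - 1)..x k}
           (\<lambda>s. (tstar \<sigma> x n - s) powr (- \<beta>) *
                deriv (quad_interp v (x (k - 1)) (x k) (x (k + 1))) s))
        + integral {x (n - 1)..tstar \<sigma> x n}
           (\<lambda>s. (tstar \<sigma> x n - s) powr (- \<beta>) * deriv (lin_interp v (x (n - 1)) (x n)) s))"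

end

theory Submission
  imports Defs
begin

text \<open>
  Let \<open>z = tstar \<sigma> x n\<close>, and for \<open>k < n\<close> let \<open>E\<^sub>k\<close> be the contribution of the interval
  \<open>{x (k - 1)..x k}\<close> to the error.  The interpolation error vanishes at both end points, so integration
  by parts moves the derivative to the kernel and bounds \<open>E\<^sub>k\<close> by the maximal interpolation error times
  \<open>(z - x k) powr (- \<beta>) - (z - x (k - 1)) powr (- \<beta>)\<close>.  On the first interval the interpolation error
  is \<open>O(x 1 powr \<mu>)\<close>, which needs only \<open>\<bar>v''\<bar> \<le> A * s powr (\<mu> - 2)\<close> and yields the exponent \<open>1 + \<beta>\<close>.
  On the others it is \<open>O(x 1 powr \<mu> * (x 1 / x k) powr (3 / r - \<mu>))\<close>, by third-order Taylor expansion and the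
  grading; the sum over the nodes in the upper half of \<open>{0..x n}\<close> telescopes through the kernel
  differences, the sum over the lower half through the powers of \<open>x k\<close>.  On the last interval the choice
  of \<open>\<sigma>\<close> makes linear interpolation exact for quadratics, up to the third-order remainder.
\<close>

section \<open>Taylor remainders and interpolation\<close>

text \<open>The two exponents in the minimum have different origins. \<open>1 + \<beta>\<close> is
  the fading memory of the first interval: seen from a distance of order \<open>x n\<close>, the
  kernel varies over it by about \<open>x 1 * x n powr (- \<beta> - 1)\<close>. The other is the
  local truncation error \<open>step x n powr (3 - \<beta>) * x n powr (\<mu> - 3)\<close>,
  rewritten by the grading. The case \<open>n = 1\<close> stands apart: a single interval holds both
  the singularity of \<open>v\<close> at \<open>0\<close> and that of the kernel at
  \<open>z\<close>. It is cut at \<open>z / 2\<close>, with integration by parts on the left half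
  and a pointwise bound on the nonsingular factor on the right half. That \<open>deriv v\<close> may
  blow up at \<open>0\<close> does little harm: for gauge integrals the fundamental theorem needs
  continuity up to the end points and a derivative inside, and it also yields the integrability
  without which \<open>integral\<close> would be the default value \<open>0\<close>. Uniformity in
  \<open>n\<close> and \<open>N\<close> comes from working on one mesh and expressing every constant
  through \<open>r\<close>, \<open>\<kappa>\<close>, \<open>\<beta>\<close>, \<open>\<mu>\<close>
  and \<open>A\<close>, where \<open>\<kappa>\<close> is chosen once for the whole family.\<close>

lemma mvt_from:
  fixes g g' :: "real \<Rightarrow> real"
  assumes "continuous_on {min b s..max b s} g" "g b = 0" "s \<noteq> b"
    and "\<And>u. min b s < u \<Longrightarrow> u < max b s \<Longrightarrow> (g has_real_derivative g' u) (at u)"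
  obtains u where "min b s < u" "u < max b s" "g s = g' u * (s - b)"
proof (cases "b < s")
  case True
  have cont: "continuous_on {b..s} g" using assms(1) True by (simp add: min_def max_def)
  have der: "\<And>u. b < u \<Longrightarrow> u < s \<Longrightarrow> (g has_derivative (\<lambda>h. g' u * h)) (at u)"
    using assms(4) True by (simp add: has_field_derivative_def min_def max_def)
  obtain u where "b < u" "u < s" "g s - g b = g' u * (s - b)"
    using mvt[OF True cont der] by blast
  then show ?thesis using that True assms(2) by (simp add: min_def max_def)
next
  case False
  then have sb: "s < b" using assms(3) by simp
  have cont: "continuous_on {s..b} g" using assms(1) sb by (simp add: min_def max_def)
  have der: "\<And>u. s < u \<Longrightarrow> u < b \<Longrightarrow> (g has_derivative (\<lambda>h. g' u * h)) (at u)"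
    using assms(4) sb by (simp add: has_field_derivative_def min_def max_def)
  obtain u where "s < u" "u < b" "g b - g s = g' u * (b - s)"
    using mvt[OF sb cont der] by blast
  then show ?thesis using that sb assms(2) by (simp add: min_def max_def algebra_simps)
qed

text \<open>The mean value theorem stands in for integrating the bound on \<open>g'\<close>. It
  keeps \<open>M\<close> instead of \<open>M / (j + 1)\<close>, so the Taylor remainders below carry
  no factorials; only constants suffer. The point \<open>s\<close> may lie on either side of
  \<open>b\<close>.\<close>

lemma abs_le_power_integrate:
  fixes g g' :: "real \<Rightarrow> real"
  assumes "continuous_on {min b s..max b s} g" "g b = 0" "0 \<le> M"
    and "\<And>u. min b s < u \<Longrightarrow> u < max b s \<Longrightarrow> (g has_real_derivative g' u) (at u)"
    and "\<And>u. min b s < u \<Longrightarrow> u < max b s \<Longrightarrow> \<bar>g' u\<bar> \<le> M * \<bar>u - b\<bar> ^ j"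
  shows "\<bar>g s\<bar> \<le> M * \<bar>s - b\<bar> ^ Suc j"
proof (cases "s = b")
  case True
  then show ?thesis using assms by simp
next
  case False
  obtain u where u: "min b s < u" "u < max b s" "g s = g' u * (s - b)"
    using mvt_from[OF assms(1,2) False assms(4)] by blast
  have "\<bar>u - b\<bar> \<le> \<bar>s - b\<bar>" using u by linarith
  then have "\<bar>g' u\<bar> \<le> M * \<bar>s - b\<bar> ^ j"
    using assms(5)[OF u(1,2)] assms(3)
    by (meson abs_ge_zero mult_left_mono order_trans power_mono)
  then have "\<bar>g' u\<bar> * \<bar>s - b\<bar> \<le> M * \<bar>s - b\<bar> ^ j * \<bar>s - b\<bar>"
    by (rule mult_right_mono) simp
  then show ?thesis by (simp add: u(3) abs_mult mult_ac)
qed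

text \<open>A convex function lies above its tangent, here the zero function. The form with
  derivatives only inside \<open>{p<..<q}\<close> and mere continuity at the ends lets
  \<open>g''\<close> blow up at \<open>p\<close>.\<close>

lemma second_order_nonneg:
  fixes g g' g'' :: "real \<Rightarrow> real"
  assumes "continuous_on {p..q} g" "g b = 0" "g' b = 0" "b \<in> {p<..<q}" "s \<in> {p..q}"
    and d1: "\<And>u. u \<in> {p<..<q} \<Longrightarrow> (g has_real_derivative g' u) (at u)"
    and d2: "\<And>u. u \<in> {p<..<q} \<Longrightarrow> (g' has_real_derivative g'' u) (at u)"
    and "\<And>u. u \<in> {p<..<q} \<Longrightarrow> 0 \<le> g'' u"
  shows "0 \<le> g s"
proof (cases "s = b")
  case True
  then show ?thesis using assms by simp
next
  case False
  have "continuous_on {min b s..max b s} g"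
    by (rule continuous_on_subset[OF assms(1)]) (use assms(4,5) in auto)
  moreover have "\<And>u. min b s < u \<Longrightarrow> u < max b s \<Longrightarrow> (g has_real_derivative g' u) (at u)"
    using assms(4,5) by (intro d1) auto
  ultimately obtain u where u: "min b s < u" "u < max b s" "g s = g' u * (s - b)"
    using mvt_from[of b s g g'] assms(2) False by blast
  then have ub: "u \<noteq> b" "u \<in> {p<..<q}" using assms(4,5) by auto
  have "continuous_on {min b u..max b u} g'"
    using ub assms(4)
    by (intro continuous_at_imp_continuous_on) (auto intro!: DERIV_isCont[OF d2])
  moreover have "\<And>w. min b u < w \<Longrightarrow> w < max b u \<Longrightarrow> (g' has_real_derivative g'' w) (at w)"
    using assms(4) ub by (intro d2) auto
  ultimately obtain w where w: "min b u < w" "w < max b u" "g' u = g'' w * (u - b)"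
    using mvt_from[of b u g' g''] assms(3) ub by blast
  have "0 \<le> g'' w" using assms(4) ub w by (intro assms(8)) auto
  moreover have "0 \<le> (u - b) * (s - b)"
    using u(1,2) by (cases "b < s") (auto intro: mult_nonneg_nonneg mult_nonpos_nonpos)
  ultimately show ?thesis by (simp add: u(3) w(3) mult.assoc)
qed

text \<open>Climbs from the bound on \<open>v3\<close> one derivative at a time; at each stage the
  Taylor part at \<open>b\<close> is subtracted, so that the remainder vanishes at \<open>b\<close>
  and \<open>abs_le_power_integrate\<close> applies. Only the remainder of \<open>v\<close> itself
  reaches the end points, where just continuity of \<open>v\<close> is given.\<close>

lemma taylor_remainders:
  fixes v v1 v2 v3 :: "real \<Rightarrow> real"
  assumes "continuous_on {p..q} v" "b \<in> {p<..<q}" "0 \<le> M"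
    and d1: "\<And>u. u \<in> {p<..<q} \<Longrightarrow> (v has_real_derivative v1 u) (at u)"
    and d2: "\<And>u. u \<in> {p<..<q} \<Longrightarrow> (v1 has_real_derivative v2 u) (at u)"
    and d3: "\<And>u. u \<in> {p<..<q} \<Longrightarrow> (v2 has_real_derivative v3 u) (at u)"
    and v3: "\<And>u. u \<in> {p<..<q} \<Longrightarrow> \<bar>v3 u\<bar> \<le> M"
  shows "\<And>s. s \<in> {p<..<q} \<Longrightarrow> \<bar>v1 s - (v1 b + v2 b * (s - b))\<bar> \<le> M * \<bar>s - b\<bar> ^ 2"
    and "\<And>s. s \<in> {p..q} \<Longrightarrow>
           \<bar>v s - (v b + v1 b * (s - b) + v2 b / 2 * (s - b)\<^sup>2)\<bar> \<le> M * \<bar>s - b\<bar> ^ 3"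
proof -
  have *: "\<bar>v2 s - v2 b\<bar> \<le> M * \<bar>s - b\<bar> ^ Suc 0" if "s \<in> {p<..<q}" for s
  proof (rule abs_le_power_integrate[where g' = v3])
    show "continuous_on {min b s..max b s} (\<lambda>a. v2 a - v2 b)"
      using that assms(2)
      by (intro continuous_at_imp_continuous_on)
        (auto intro!: continuous_intros DERIV_isCont[OF d3])
    fix u assume "min b s < u" "u < max b s"
    then have u: "u \<in> {p<..<q}" using that assms(2) by auto
    show "((\<lambda>a. v2 a - v2 b) has_real_derivative v3 u) (at u)"
      using d3[OF u] by (auto intro!: derivative_eq_intros)
    show "\<bar>v3 u\<bar> \<le> M * \<bar>u - b\<bar> ^ 0" using v3[OF u] by simp
  qed (use assms in auto)
  have **: "\<bar>v1 s - (v1 b + v2 b * (s - b))\<bar> \<le> M * \<bar>s - b\<bar> ^ Suc (Suc 0)"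
    if "s \<in> {p<..<q}" for s
  proof (rule abs_le_power_integrate[where g' = "\<lambda>s. v2 s - v2 b"])
    show "continuous_on {min b s..max b s} (\<lambda>s. v1 s - (v1 b + v2 b * (s - b)))"
      using that assms(2)
      by (intro continuous_at_imp_continuous_on)
        (auto intro!: continuous_intros DERIV_isCont[OF d2])
    fix u assume "min b s < u" "u < max b s"
    then have u: "u \<in> {p<..<q}" using that assms(2) by auto
    show "((\<lambda>s. v1 s - (v1 b + v2 b * (s - b))) has_real_derivative v2 u - v2 b) (at u)"
      using d2[OF u] by (auto intro!: derivative_eq_intros)
    show "\<bar>v2 u - v2 b\<bar> \<le> M * \<bar>u - b\<bar> ^ Suc 0" using *[OF u] .
  qed (use assms in auto)
  show "\<bar>v1 s - (v1 b + v2 b * (s - b))\<bar> \<le> M * \<bar>s - b\<bar> ^ 2" if "s \<in> {p<..<q}" for s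
    using **[OF that] by (simp add: numeral_2_eq_2)
  have "\<bar>v s - (v b + v1 b * (s - b) + v2 b / 2 * (s - b)\<^sup>2)\<bar> \<le> M * \<bar>s - b\<bar> ^ Suc (Suc (Suc 0))"
    if "s \<in> {p..q}" for s
  proof (rule abs_le_power_integrate[where g' = "\<lambda>s. v1 s - (v1 b + v2 b * (s - b))"])
    show "continuous_on {min b s..max b s} (\<lambda>s. v s - (v b + v1 b * (s - b) + v2 b / 2 * (s - b)\<^sup>2))"
      using that assms(2)
      by (intro continuous_intros continuous_on_subset[OF assms(1)]) auto
    fix u assume "min b s < u" "u < max b s"
    then have u: "u \<in> {p<..<q}" using that assms(2) by auto
    show "((\<lambda>s. v s - (v b + v1 b * (s - b) + v2 b / 2 * (s - b)\<^sup>2)) has_real_derivative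
        v1 u - (v1 b + v2 b * (u - b))) (at u)"
      using d1[OF u] by (auto intro!: derivative_eq_intros)
    show "\<bar>v1 u - (v1 b + v2 b * (u - b))\<bar> \<le> M * \<bar>u - b\<bar> ^ Suc (Suc 0)" using **[OF u] .
  qed (use assms in auto)
  then show "\<bar>v s - (v b + v1 b * (s - b) + v2 b / 2 * (s - b)\<^sup>2)\<bar> \<le> M * \<bar>s - b\<bar> ^ 3"
    if "s \<in> {p..q}" for s
    using that by (simp add: numeral_3_eq_3)
qed

lemma quad_interp_diff:
  "quad_interp (\<lambda>s. f s - g s) a b c s = quad_interp f a b c s - quad_interp g a b c s"
  unfolding quad_interp_def
    left_diff_distrib[of "f a" "g a"] left_diff_distrib[of "f b" "g b"] left_diff_distrib[of "f c" "g c"]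
  by simp

lemma quad_interp_quadratic:
  assumes "a \<noteq> b" "b \<noteq> c" "a \<noteq> c"
  shows "quad_interp (\<lambda>s. A + B * (s - b) + D * (s - b)\<^sup>2) a b c s = A + B * (s - b) + D * (s - b)\<^sup>2"
proof -
  \<comment> \<open>With the middle node as origin the three weights get the common denominator
    \<open>x * y * (x - y)\<close>, and the claim reduces to a single polynomial identity.\<close>
  define x y z where "x = a - b" and "y = c - b" and "z = s - b"
  have e: "a - c = x - y" "b - a = - x" "b - c = - y" "c - a = y - x" "a - b = x" "c - b = y"
    "s - b = z" "s - c = z - y" "s - a = z - x" by (auto simp: x_def y_def z_def)
  have n: "x \<noteq> 0" "y \<noteq> 0" "x - y \<noteq> 0" "y - x \<noteq> 0" using assms by (auto simp: x_def y_def)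
  have s1: "z * (z - y) / (x * (x - y)) = z * (z - y) * y / (x * y * (x - y))" using n by simp
  have s2: "(z - x) * (z - y) / (- x * - y) = (z - x) * (z - y) * (x - y) / (x * y * (x - y))"
    using n by simp
  have s3: "(z - x) * z / ((y - x) * y) = - ((z - x) * z) * x / (x * y * (x - y))"
    using n by (simp add: divide_simps) (simp add: algebra_simps)
  have "(A + B * x + D * x\<^sup>2) * (z * (z - y) * y) + A * ((z - x) * (z - y) * (x - y))
      + (A + B * y + D * y\<^sup>2) * (- ((z - x) * z) * x) = (A + B * z + D * z\<^sup>2) * (x * y * (x - y))"
    by (simp add: algebra_simps power2_eq_square)
  then have "((A + B * x + D * x\<^sup>2) * (z * (z - y) * y) + A * ((z - x) * (z - y) * (x - y))
      + (A + B * y + D * y\<^sup>2) * (- ((z - x) * z) * x)) / (x * y * (x - y)) = A + B * z + D * z\<^sup>2"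
    using n by (subst nonzero_divide_eq_eq) auto
  then show ?thesis
    unfolding quad_interp_def e s1 s2 s3 using n by (simp only: add_divide_distrib) simp
qed

text \<open>Since \<open>w b = 0\<close>, two weights remain. On the left interval the weight of
  \<open>a\<close> is at most 1; that of \<open>c\<close> is at most
  \<open>(b - a) / (c - b)\<close>, which is why the next step must not be much shorter than the
  present one.\<close>

lemma abs_quad_interp_le:
  assumes "a < b" "b < c" "s \<in> {a..b}" "w b = 0" "\<bar>w a\<bar> \<le> B" "\<bar>w c\<bar> \<le> B"
    and rho: "b - a \<le> \<rho> * (c - b)"
  shows "\<bar>quad_interp w a b c s\<bar> \<le> B * (1 + \<rho>)"
proof -
  have B: "0 \<le> B" using assms(5) by linarith
  have "\<bar>(s - b) * (s - c) / ((a - b) * (a - c))\<bar> = (b - s) * (c - s) / ((b - a) * (c - a))"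
    using assms by (simp add: abs_mult)
  also have "\<dots> \<le> 1"
    using assms by (simp add: divide_le_eq mult_mono)
  finally have 1: "\<bar>(s - b) * (s - c) / ((a - b) * (a - c))\<bar> \<le> 1" .
  have "\<bar>(s - a) * (s - b) / ((c - a) * (c - b))\<bar> = (s - a) / (c - a) * ((b - s) / (c - b))"
    using assms by (simp add: abs_mult)
  also have "\<dots> \<le> 1 * \<rho>"
  proof (rule mult_mono)
    have "(b - s) / (c - b) \<le> (b - a) / (c - b)" using assms by (simp add: divide_right_mono)
    also have "\<dots> \<le> \<rho>" using assms by (simp add: divide_le_eq)
    finally show "(b - s) / (c - b) \<le> \<rho>" .
  qed (use assms in auto)
  finally have 2: "\<bar>(s - a) * (s - b) / ((c - a) * (c - b))\<bar> \<le> \<rho>" by simp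
  have "\<bar>quad_interp w a b c s\<bar> \<le> \<bar>w a\<bar> * \<bar>(s - b) * (s - c) / ((a - b) * (a - c))\<bar>
      + \<bar>w c\<bar> * \<bar>(s - a) * (s - b) / ((c - a) * (c - b))\<bar>"
    using assms(4) unfolding quad_interp_def
    by (metis (no_types, lifting) abs_mult abs_triangle_ineq add.right_neutral mult_zero_left)
  also have "\<dots> \<le> B * 1 + B * \<rho>"
    by (intro add_mono mult_mono 1 2 assms) (use B in auto)
  finally show ?thesis by (simp add: algebra_simps)
qed

text \<open>Interpolation reproduces the quadratic, so the error is that of the difference, which
  vanishes at \<open>b\<close>: at most \<open>B\<close> from the difference and
  \<open>B * (1 + \<rho>)\<close> from its interpolant. The quadratic is free apart from its value
  at \<open>b\<close>; it will be a tangent on the first interval and a Taylor polynomial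
  elsewhere.\<close>

lemma quad_interp_error_le:
  assumes "a < b" "b < c" "s \<in> {a..b}"
    and "b - a \<le> \<rho> * (c - b)"
    and "v b = A"
    and "\<And>u. u \<in> {a..c} \<Longrightarrow> \<bar>v u - (A + D * (u - b) + E * (u - b)\<^sup>2)\<bar> \<le> B"
  shows "\<bar>v s - quad_interp v a b c s\<bar> \<le> (2 + \<rho>) * B"
proof -
  define p where "p u = A + D * (u - b) + E * (u - b)\<^sup>2" for u
  have "quad_interp (\<lambda>u. v u - p u) a b c s = quad_interp v a b c s - p s"
    using assms unfolding quad_interp_diff p_def by (simp add: quad_interp_quadratic)
  moreover have "\<bar>quad_interp (\<lambda>u. v u - p u) a b c s\<bar> \<le> B * (1 + \<rho>)"
    by (rule abs_quad_interp_le) (use assms in \<open>auto simp: p_def\<close>)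
  moreover have "\<bar>v s - p s\<bar> \<le> B" using assms by (auto simp: p_def)
  ultimately show ?thesis by (simp add: algebra_simps)
qed

lemma quad_interp_nodes:
  assumes "a < b" "b < c"
  shows "quad_interp v a b c a = v a" "quad_interp v a b c b = v b"
  using assms by (auto simp: quad_interp_def)

lemma DERIV_quad_interp:
  "\<exists>m d. \<forall>s. (quad_interp v a b c has_real_derivative m + d * s) (at s)"
proof -
  define A B C where "A = v a / ((a - b) * (a - c))" and "B = v b / ((b - a) * (b - c))"
    and "C = v c / ((c - a) * (c - b))"
  have "quad_interp v a b c =
      (\<lambda>s. A * ((s - b) * (s - c)) + B * ((s - a) * (s - c)) + C * ((s - a) * (s - b)))"
    by (auto simp: quad_interp_def A_def B_def C_def)
  then have "(quad_interp v a b c has_real_derivative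
      (A * - (b + c) + B * - (a + c) + C * - (a + b)) + (2 * (A + B + C)) * s) (at s)" for s
    by (auto intro!: derivative_eq_intros simp: algebra_simps)
  then show ?thesis by blast
qed

lemma DERIV_lin_interp:
  assumes "a \<noteq> b"
  shows "(lin_interp v a b has_real_derivative (v b - v a) / (b - a)) (at s)"
  unfolding lin_interp_def using assms
  by (auto intro!: derivative_eq_intros simp: divide_simps) (simp add: algebra_simps)

section \<open>The weakly singular kernel\<close>

lemma kernel_has_integral:
  fixes a z p :: real
  assumes "a \<le> z" "-1 < p"
  shows "((\<lambda>s. (z - s) powr p) has_integral (z - a) powr (p + 1) / (p + 1)) {a..z}"
proof -
  have "((\<lambda>s. (z - s) powr p) has_integral
      (- ((z - z) powr (p + 1)) / (p + 1) - - ((z - a) powr (p + 1)) / (p + 1))) {a..z}"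
  proof (rule fundamental_theorem_of_calculus_interior)
    show "continuous_on {a..z} (\<lambda>s. - ((z - s) powr (p + 1)) / (p + 1))"
      using assms by (intro continuous_intros continuous_on_powr') auto
    fix s assume "s \<in> {a<..<z}"
    then show "((\<lambda>s. - ((z - s) powr (p + 1)) / (p + 1)) has_vector_derivative (z - s) powr p) (at s)"
      using assms by (auto intro!: derivative_eq_intros
          simp: has_real_derivative_iff_has_vector_derivative[symmetric])
  qed (use assms in auto)
  then show ?thesis using assms by simp
qed

text \<open>For intervals that reach the kernel singularity \<open>z\<close>, where integration by
  parts would meet an infinite kernel value.\<close>

lemma kernel_mult_bounded:
  fixes f :: "real \<Rightarrow> real"
  assumes "a \<le> z" "\<beta> < 1" "continuous_on {a..z} f" "\<And>s. s \<in> {a..z} \<Longrightarrow> \<bar>f s\<bar> \<le> B"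
  shows "(\<lambda>s. (z - s) powr (- \<beta>) * f s) integrable_on {a..z}"
    and "\<bar>integral {a..z} (\<lambda>s. (z - s) powr (- \<beta>) * f s)\<bar> \<le> B * ((z - a) powr (1 - \<beta>) / (1 - \<beta>))"
proof -
  have K: "((\<lambda>s. (z - s) powr (- \<beta>)) has_integral (z - a) powr (1 - \<beta>) / (1 - \<beta>)) {a..z}"
    using kernel_has_integral[of a z "- \<beta>"] assms by simp
  have "(\<lambda>s. (z - s) powr (- \<beta>)) absolutely_integrable_on {a..z}"
    using K by (intro nonnegative_absolutely_integrable_1) auto
  moreover have "bounded (f ` {a..z})"
    using assms(3) by (intro compact_imp_bounded compact_continuous_image) auto
  moreover have "f \<in> borel_measurable (lebesgue_on {a..z})"
    using assms(3) by (intro continuous_imp_measurable_on_sets_lebesgue) auto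
  ultimately have "(\<lambda>s. f s * (z - s) powr (- \<beta>)) absolutely_integrable_on {a..z}"
    by (intro absolutely_integrable_bounded_measurable_product_real) auto
  then show int: "(\<lambda>s. (z - s) powr (- \<beta>) * f s) integrable_on {a..z}"
    by (simp add: mult.commute set_lebesgue_integral_eq_integral)
  have "norm (integral {a..z} (\<lambda>s. (z - s) powr (- \<beta>) * f s)) \<le>
      integral {a..z} (\<lambda>s. B * (z - s) powr (- \<beta>))"
  proof (rule integral_norm_bound_integral[OF int])
    show "(\<lambda>s. B * (z - s) powr (- \<beta>)) integrable_on {a..z}"
      using has_integral_mult_right[OF K] by blast
    fix s assume "s \<in> {a..z}"
    then show "norm ((z - s) powr (- \<beta>) * f s) \<le> B * (z - s) powr (- \<beta>)"
      using mult_right_mono[OF assms(4), of s "(z - s) powr (- \<beta>)"] by (simp add: abs_mult mult.commute)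
  qed
  also have "\<dots> = B * ((z - a) powr (1 - \<beta>) / (1 - \<beta>))"
    using has_integral_mult_right[OF K] by (intro integral_unique) auto
  finally show "\<bar>integral {a..z} (\<lambda>s. (z - s) powr (- \<beta>) * f s)\<bar> \<le>
      B * ((z - a) powr (1 - \<beta>) / (1 - \<beta>))" by simp
qed

text \<open>The derivative \<open>k\<close> of the kernel is nonnegative, so its integral is exactly
  the kernel difference and these bounds telescope over adjacent intervals. Integrability comes from
  the product rule, which permits \<open>g'\<close> to be unbounded at the ends. The boundary term
  is zero for an interpolation error between nodes but is kept for the cut at
  \<open>z / 2\<close>.\<close>

lemma kernel_by_parts:
  fixes g g' :: "real \<Rightarrow> real"
  assumes "a \<le> b" "b < z" "0 < \<beta>" "continuous_on {a..b} g"
    and "\<And>s. s \<in> {a<..<b} \<Longrightarrow> (g has_real_derivative g' s) (at s)"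
    and "\<And>s. s \<in> {a..b} \<Longrightarrow> \<bar>g s\<bar> \<le> B"
  shows "(\<lambda>s. (z - s) powr (- \<beta>) * g' s) integrable_on {a..b}"
    and "\<bar>integral {a..b} (\<lambda>s. (z - s) powr (- \<beta>) * g' s)\<bar> \<le>
      \<bar>(z - b) powr (- \<beta>) * g b - (z - a) powr (- \<beta>) * g a\<bar>
      + B * ((z - b) powr (- \<beta>) - (z - a) powr (- \<beta>))"
proof -
  define k where "k s = \<beta> * (z - s) powr (- \<beta> - 1)" for s
  have K: "(k has_integral ((z - b) powr (- \<beta>) - (z - a) powr (- \<beta>))) {a..b}"
    unfolding k_def
    by (rule fundamental_theorem_of_calculus)
      (use assms in \<open>auto intro!: derivative_eq_intros simp: has_real_derivative_iff_has_vector_derivative[symmetric]\<close>)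
  have "continuous_on {a..b} (\<lambda>s. k s * g s)"
    unfolding k_def using assms by (intro continuous_intros) auto
  then have kg: "(\<lambda>s. k s * g s) integrable_on {a..b}" by (rule integrable_continuous_interval)
  have F: "((\<lambda>s. (z - s) powr (- \<beta>) * g' s + k s * g s) has_integral
     ((z - b) powr (- \<beta>) * g b - (z - a) powr (- \<beta>) * g a)) {a..b}"
  proof (rule fundamental_theorem_of_calculus_interior)
    show "continuous_on {a..b} (\<lambda>s. (z - s) powr (- \<beta>) * g s)"
      using assms by (intro continuous_intros) auto
    fix s assume "s \<in> {a<..<b}"
    then show "((\<lambda>s. (z - s) powr (- \<beta>) * g s) has_vector_derivative
        (z - s) powr (- \<beta>) * g' s + k s * g s) (at s)"
      using assms by (auto intro!: derivative_eq_intros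
          simp: has_real_derivative_iff_has_vector_derivative[symmetric] k_def)
  qed fact
  have *: "((\<lambda>s. (z - s) powr (- \<beta>) * g' s) has_integral
     ((z - b) powr (- \<beta>) * g b - (z - a) powr (- \<beta>) * g a) - integral {a..b} (\<lambda>s. k s * g s)) {a..b}"
    using has_integral_diff[OF F integrable_integral[OF kg]] by simp
  then show "(\<lambda>s. (z - s) powr (- \<beta>) * g' s) integrable_on {a..b}" by blast
  have "norm (integral {a..b} (\<lambda>s. k s * g s)) \<le> integral {a..b} (\<lambda>s. B * k s)"
  proof (rule integral_norm_bound_integral[OF kg])
    show "(\<lambda>s. B * k s) integrable_on {a..b}" using has_integral_mult_right[OF K] by blast
    fix s assume s: "s \<in> {a..b}"
    have "0 \<le> k s" using assms by (simp add: k_def)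
    then show "norm (k s * g s) \<le> B * k s"
      using mult_right_mono[OF assms(6)[OF s], of "k s"] by (simp add: abs_mult mult.commute)
  qed
  also have "\<dots> = B * ((z - b) powr (- \<beta>) - (z - a) powr (- \<beta>))"
    using has_integral_mult_right[OF K] by (intro integral_unique) auto
  finally show "\<bar>integral {a..b} (\<lambda>s. (z - s) powr (- \<beta>) * g' s)\<bar> \<le>
      \<bar>(z - b) powr (- \<beta>) * g b - (z - a) powr (- \<beta>) * g a\<bar>
      + B * ((z - b) powr (- \<beta>) - (z - a) powr (- \<beta>))"
    using integral_unique[OF *] by simp
qed

text \<open>The reason for the choice \<open>\<sigma> = 1 - \<beta> / 2\<close>.\<close>

lemma kernel_midpoint_orthogonal:
  fixes a b \<beta> :: real
  assumes "a < b" "0 < \<beta>" "\<beta> < 1" "z = b - \<beta> / 2 * (b - a)"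
  shows "((\<lambda>s. (z - s) powr (- \<beta>) * (s - (a + b) / 2)) has_integral 0) {a..z}"
proof -
  have za: "z - a = (1 - \<beta> / 2) * (b - a)" using assms(4) by (simp add: algebra_simps)
  have pos: "0 < z - a" using assms za by simp
  have 1: "((\<lambda>s. (z - (a + b) / 2) * (z - s) powr (- \<beta>) - (z - s) powr (1 - \<beta>)) has_integral
      ((z - (a + b) / 2) * ((z - a) powr (1 - \<beta>) / (1 - \<beta>)) - (z - a) powr (2 - \<beta>) / (2 - \<beta>))) {a..z}"
  proof (intro has_integral_diff has_integral_mult_right)
    show "((\<lambda>s. (z - s) powr (- \<beta>)) has_integral (z - a) powr (1 - \<beta>) / (1 - \<beta>)) {a..z}"
      using kernel_has_integral[of a z "- \<beta>"] pos \<open>\<beta> < 1\<close> by simp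
    have "1 - \<beta> + 1 = 2 - \<beta>" by simp
    then show "((\<lambda>s. (z - s) powr (1 - \<beta>)) has_integral (z - a) powr (2 - \<beta>) / (2 - \<beta>)) {a..z}"
      using kernel_has_integral[of a z "1 - \<beta>"] pos \<open>\<beta> < 1\<close> by simp
  qed
  have "(z - a) powr (2 - \<beta>) = (z - a) * (z - a) powr (1 - \<beta>)"
  proof -
    have "2 - \<beta> = 1 + (1 - \<beta>)" by simp
    then show ?thesis using pos by (simp only: powr_add) simp
  qed
  \<comment> \<open>Here the position of \<open>z\<close> matters: \<open>z - (a + b) / 2\<close>
    and \<open>z - a\<close> are \<open>1 - \<beta>\<close> and \<open>2 - \<beta>\<close> times the
    half step, which cancels the denominators left by integrating the two powers.\<close>
  moreover have "(z - (a + b) / 2) / (1 - \<beta>) - (z - a) / (2 - \<beta>) = 0"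
  proof -
    have "z - (a + b) / 2 = (1 - \<beta>) * ((b - a) / 2)" "z - a = (2 - \<beta>) * ((b - a) / 2)"
      using assms(4) by (simp_all add: field_simps)
    then have "(z - (a + b) / 2) / (1 - \<beta>) = (b - a) / 2" "(z - a) / (2 - \<beta>) = (b - a) / 2"
      using \<open>\<beta> < 1\<close> by (simp_all only: nonzero_mult_div_cancel_left[of "1 - \<beta>"] nonzero_mult_div_cancel_left[of "2 - \<beta>"])
    then show ?thesis by (simp only: diff_self)
  qed
  ultimately have 2: "(z - (a + b) / 2) * ((z - a) powr (1 - \<beta>) / (1 - \<beta>)) - (z - a) powr (2 - \<beta>) / (2 - \<beta>) = 0"
    by (metis (no_types, opaque_lifting) diff_eq_diff_eq diff_zero mult.commute times_divide_eq_left times_divide_eq_right)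
  show ?thesis
  proof (rule has_integral_eq[OF _ 1[unfolded 2]])
    fix s assume "s \<in> {a..z}"
    then have "(z - s) powr (1 - \<beta>) = (z - s) * (z - s) powr (- \<beta>)"
      by (cases "s = z") (auto simp: powr_mult_base)
    then show "(z - (a + b) / 2) * (z - s) powr - \<beta> - (z - s) powr (1 - \<beta>) =
         (z - s) powr - \<beta> * (s - (a + b) / 2)" by (simp add: algebra_simps)
  qed
qed

section \<open>Functions with a power singularity at the origin\<close>

text \<open>The tangent remainder at \<open>b\<close> of
  \<open>s powr \<mu> / (\<mu> * (\<mu> - 1))\<close>, for
  \<open>0 \<le> s \<le> \<kappa> * b\<close>, is bounded by this multiple of
  \<open>b powr \<mu>\<close>; the three summands of the numerator account for the value at
  \<open>s\<close>, the value at \<open>b\<close> and the linear term.\<close>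

definition tangent_const :: "real \<Rightarrow> real \<Rightarrow> real" where
  "tangent_const \<mu> \<kappa> = (\<kappa> powr \<mu> + 1 + \<mu> * \<kappa>) / (\<mu> * \<bar>\<mu> - 1\<bar>)"

text \<open>The summand 1 of the theorem's bounds is gone: for orders 2 and 3 the exponent is
  negative, so on a bounded interval the power dominates a constant. Derivatives are two-sided,
  hence the open interval.\<close>

locale weakly_singular =
  fixes v v1 v2 v3 :: "real \<Rightarrow> real" and T \<mu> A :: real
  assumes mu: "0 < \<mu>" "\<mu> < 2" "\<mu> \<noteq> 1" and A_nonneg: "0 \<le> A"
    and cont: "continuous_on {0..T} v"
    and d1: "\<And>s. s \<in> {0<..<T} \<Longrightarrow> (v has_real_derivative v1 s) (at s)"
    and d2: "\<And>s. s \<in> {0<..<T} \<Longrightarrow> (v1 has_real_derivative v2 s) (at s)"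
    and d3: "\<And>s. s \<in> {0<..<T} \<Longrightarrow> (v2 has_real_derivative v3 s) (at s)"
    and bound2: "\<And>s. s \<in> {0<..<T} \<Longrightarrow> \<bar>v2 s\<bar> \<le> A * s powr (\<mu> - 2)"
    and bound3: "\<And>s. s \<in> {0<..<T} \<Longrightarrow> \<bar>v3 s\<bar> \<le> A * s powr (\<mu> - 3)"
begin

lemma deriv_v: "s \<in> {0<..<T} \<Longrightarrow> deriv v s = v1 s"
  using d1 by (rule DERIV_imp_deriv)

lemma continuous_on_v1: "S \<subseteq> {0<..<T} \<Longrightarrow> continuous_on S v1"
  by (intro continuous_at_imp_continuous_on) (auto intro: DERIV_isCont[OF d2])

text \<open>The remainder is compared with that of \<open>s powr \<mu> / (\<mu> * (\<mu> - 1))\<close>, whose second derivative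
  is \<open>s powr (\<mu> - 2)\<close>; this needs no information on \<open>v\<close> at the singular point \<open>0\<close>.\<close>

lemma tangent_error:
  assumes b: "b \<in> {0<..<T}" and s: "s \<in> {0..T}" "s \<le> \<kappa> * b" and "1 \<le> \<kappa>"
  shows "\<bar>v s - (v b + v1 b * (s - b))\<bar> \<le> A * tangent_const \<mu> \<kappa> * b powr \<mu>"
proof -
  define \<phi> where "\<phi> s = s powr \<mu> / (\<mu> * (\<mu> - 1))" for s
  define \<phi>1 where "\<phi>1 s = s powr (\<mu> - 1) / (\<mu> - 1)" for s :: real
  have p1: "(\<phi> has_real_derivative \<phi>1 u) (at u)" if "0 < u" for u
    unfolding \<phi>_def \<phi>1_def using that mu by (auto intro!: derivative_eq_intros)
  have p2: "(\<phi>1 has_real_derivative u powr (\<mu> - 2)) (at u)" if "0 < u" for u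
    unfolding \<phi>1_def using that mu by (auto intro!: derivative_eq_intros)
  have cphi: "continuous_on {0..T} \<phi>"
    unfolding \<phi>_def using mu by (intro continuous_intros continuous_on_powr') auto
  define R where "R = \<phi> s - (\<phi> b + \<phi>1 b * (s - b))"
  define w where "w s = v s - (v b + v1 b * (s - b))" for s
  \<comment> \<open>By \<open>bound2\<close>, \<open>A * \<phi> + e * v\<close> has nonnegative
    second derivative for \<open>e = 1\<close> and for \<open>e = -1\<close>, hence lies above its
    tangent at \<open>b\<close>. The two inequalities together say that
    \<open>\<bar>w s\<bar>\<close> is at most \<open>A * R\<close>.\<close>
  have sgn: "0 \<le> A * R + e * w s" if e: "\<bar>e\<bar> = 1" for e
  proof -
    have "0 \<le> A * (\<phi> s - (\<phi> b + \<phi>1 b * (s - b))) + e * (v s - (v b + v1 b * (s - b)))"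
    proof (rule second_order_nonneg[where p = 0 and q = T and b = b and s = s
          and g = "\<lambda>s. A * (\<phi> s - (\<phi> b + \<phi>1 b * (s - b))) + e * (v s - (v b + v1 b * (s - b)))"
          and g' = "\<lambda>s. A * (\<phi>1 s - \<phi>1 b) + e * (v1 s - v1 b)"
          and g'' = "\<lambda>s. A * s powr (\<mu> - 2) + e * v2 s"])
      show "continuous_on {0..T} (\<lambda>s. A * (\<phi> s - (\<phi> b + \<phi>1 b * (s - b))) + e * (v s - (v b + v1 b * (s - b))))"
        by (intro continuous_intros cphi cont)
      fix u assume u: "u \<in> {0<..<T}"
      show "((\<lambda>s. A * (\<phi> s - (\<phi> b + \<phi>1 b * (s - b))) + e * (v s - (v b + v1 b * (s - b))))
        has_real_derivative A * (\<phi>1 u - \<phi>1 b) + e * (v1 u - v1 b)) (at u)"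
        using u by (auto intro!: derivative_eq_intros p1 d1[OF u])
      show "((\<lambda>s. A * (\<phi>1 s - \<phi>1 b) + e * (v1 s - v1 b))
        has_real_derivative A * u powr (\<mu> - 2) + e * v2 u) (at u)"
        using u by (auto intro!: derivative_eq_intros p2 d2[OF u])
      have "\<bar>e * v2 u\<bar> \<le> A * u powr (\<mu> - 2)" using bound2[OF u] e by (simp add: abs_mult)
      then show "0 \<le> A * u powr (\<mu> - 2) + e * v2 u" by linarith
    qed (use b s in auto)
    then show ?thesis by (simp add: R_def w_def)
  qed
  have "\<bar>w s\<bar> \<le> A * R" using sgn[of 1] sgn[of "-1"] by linarith
  also have "\<dots> \<le> A * (tangent_const \<mu> \<kappa> * b powr \<mu>)"
  proof (rule mult_left_mono[OF _ A_nonneg])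
    have D: "0 < \<mu> * \<bar>\<mu> - 1\<bar>" using mu by simp
    have sm: "s powr \<mu> \<le> \<kappa> powr \<mu> * b powr \<mu>"
      using s b \<open>1 \<le> \<kappa>\<close> mu by (auto simp: powr_mult[symmetric] intro!: powr_mono2)
    have "b \<le> \<kappa> * b" using b \<open>1 \<le> \<kappa>\<close> by simp
    then have "\<bar>s - b\<bar> \<le> \<kappa> * b" using s b unfolding atLeastAtMost_iff greaterThanLessThan_iff by linarith
    then have "b powr (\<mu> - 1) * \<bar>s - b\<bar> \<le> b powr (\<mu> - 1) * (\<kappa> * b)" by (intro mult_left_mono) auto
    also have "\<dots> = \<kappa> * b powr \<mu>" using b by (simp add: powr_diff)
    finally have sb: "\<mu> * (b powr (\<mu> - 1) * \<bar>s - b\<bar>) \<le> \<mu> * \<kappa> * b powr \<mu>" using mu by simp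
    have "R * (\<mu> * (\<mu> - 1)) = s powr \<mu> - (b powr \<mu> + \<mu> * (b powr (\<mu> - 1) * (s - b)))"
    proof -
      have "R * (\<mu> * (\<mu> - 1)) =
          \<phi> s * (\<mu> * (\<mu> - 1)) - (\<phi> b * (\<mu> * (\<mu> - 1)) + \<phi>1 b * (\<mu> * (\<mu> - 1)) * (s - b))"
        unfolding R_def by (simp only: algebra_simps)
      moreover have "\<phi> x * (\<mu> * (\<mu> - 1)) = x powr \<mu>" for x using mu by (simp add: \<phi>_def)
      moreover have "\<phi>1 b * (\<mu> * (\<mu> - 1)) = \<mu> * b powr (\<mu> - 1)" using mu by (simp add: \<phi>1_def)
      ultimately show ?thesis by (simp only: mult.assoc)
    qed
    then have "\<bar>R\<bar> * (\<mu> * \<bar>\<mu> - 1\<bar>) = \<bar>s powr \<mu> - (b powr \<mu> + \<mu> * (b powr (\<mu> - 1) * (s - b)))\<bar>"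
      using mu by (metis abs_mult abs_of_pos)
    also have "\<dots> \<le> s powr \<mu> + b powr \<mu> + \<bar>\<mu> * (b powr (\<mu> - 1) * (s - b))\<bar>"
      using powr_ge_zero[of s \<mu>] powr_ge_zero[of b \<mu>] by linarith
    also have "\<bar>\<mu> * (b powr (\<mu> - 1) * (s - b))\<bar> = \<mu> * (b powr (\<mu> - 1) * \<bar>s - b\<bar>)"
      using mu by (simp add: abs_mult)
    also have "s powr \<mu> + b powr \<mu> + \<mu> * (b powr (\<mu> - 1) * \<bar>s - b\<bar>)
        \<le> (\<kappa> powr \<mu> + 1 + \<mu> * \<kappa>) * b powr \<mu>"
      using sm sb by (simp add: algebra_simps)
    finally have "\<bar>R\<bar> \<le> tangent_const \<mu> \<kappa> * b powr \<mu>"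
      using D by (simp add: tangent_const_def field_simps)
    then show "R \<le> tangent_const \<mu> \<kappa> * b powr \<mu>" by linarith
  qed
  finally show ?thesis by (simp add: w_def mult.assoc)
qed

text \<open>The error is zero at \<open>a\<close> and \<open>b\<close>, so the boundary term of
  \<open>kernel_by_parts\<close> drops out. Integrability of the part with \<open>deriv v\<close> is
  recovered by adding back the part of the interpolant, whose derivative is affine; thus
  \<open>a = 0\<close> is allowed.\<close>

lemma quad_piece:
  assumes "0 \<le> a" "a < b" "b < c" "c \<le> T" "b < z" "0 < \<beta>"
    and "\<And>s. s \<in> {a..b} \<Longrightarrow> \<bar>v s - quad_interp v a b c s\<bar> \<le> B"
  shows "(\<lambda>s. (z - s) powr (- \<beta>) * deriv v s) integrable_on {a..b}"
    and "\<bar>integral {a..b} (\<lambda>s. (z - s) powr (- \<beta>) * deriv v s)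
        - integral {a..b} (\<lambda>s. (z - s) powr (- \<beta>) * deriv (quad_interp v a b c) s)\<bar>
      \<le> B * ((z - b) powr (- \<beta>) - (z - a) powr (- \<beta>))"
proof -
  let ?P = "quad_interp v a b c"
  obtain m d where P: "\<And>s. (?P has_real_derivative m + d * s) (at s)"
    using DERIV_quad_interp by blast
  have dP: "deriv ?P = (\<lambda>s. m + d * s)" using P by (auto intro!: DERIV_imp_deriv)
  have iP: "(\<lambda>s. (z - s) powr (- \<beta>) * deriv ?P s) integrable_on {a..b}"
    unfolding dP using assms by (intro integrable_continuous_interval continuous_intros) auto
  have cP: "continuous_on S ?P" for S
    using P by (intro continuous_at_imp_continuous_on) (auto intro: DERIV_isCont)
  have cg: "continuous_on {a..b} (\<lambda>s. v s - ?P s)"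
    using assms by (intro continuous_intros cP continuous_on_subset[OF cont]) auto
  have dg: "((\<lambda>s. v s - ?P s) has_real_derivative deriv v s - deriv ?P s) (at s)"
    if "s \<in> {a<..<b}" for s
  proof -
    have "s \<in> {0<..<T}" using that assms by auto
    then show ?thesis using P by (auto intro!: derivative_eq_intros d1 simp: deriv_v dP)
  qed
  note parts = kernel_by_parts[of a b z \<beta> "\<lambda>s. v s - ?P s" "\<lambda>s. deriv v s - deriv ?P s" B]
  have "a \<le> b" using assms by simp
  note int = parts(1)[OF this \<open>b < z\<close> \<open>0 < \<beta>\<close> cg dg assms(7)]
    and bd = parts(2)[OF this \<open>b < z\<close> \<open>0 < \<beta>\<close> cg dg assms(7)]
  have "(\<lambda>s. (z - s) powr (- \<beta>) * (deriv v s - deriv ?P s) + (z - s) powr (- \<beta>) * deriv ?P s) integrable_on {a..b}"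
    by (rule integrable_add[OF int iP])
  then show iv: "(\<lambda>s. (z - s) powr (- \<beta>) * deriv v s) integrable_on {a..b}"
    by (simp add: algebra_simps)
  have "integral {a..b} (\<lambda>s. (z - s) powr (- \<beta>) * (deriv v s - deriv ?P s)) =
     integral {a..b} (\<lambda>s. (z - s) powr (- \<beta>) * deriv v s)
        - integral {a..b} (\<lambda>s. (z - s) powr (- \<beta>) * deriv ?P s)"
    using integral_diff[OF iv iP] by (simp add: right_diff_distrib)
  then show "\<bar>integral {a..b} (\<lambda>s. (z - s) powr (- \<beta>) * deriv v s)
        - integral {a..b} (\<lambda>s. (z - s) powr (- \<beta>) * deriv (quad_interp v a b c) s)\<bar>
      \<le> B * ((z - b) powr (- \<beta>) - (z - a) powr (- \<beta>))"
    using bd quad_interp_nodes[OF assms(2,3), of v] by simp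
qed

lemma quad_error_first:
  assumes "0 < b" "b < c" "c \<le> T" "b \<le> \<rho> * (c - b)" "c \<le> \<kappa> * b" "s \<in> {0..b}"
  shows "\<bar>v s - quad_interp v 0 b c s\<bar> \<le> (2 + \<rho>) * (A * tangent_const \<mu> \<kappa> * b powr \<mu>)"
proof (rule quad_interp_error_le[where A = "v b" and D = "v1 b" and E = 0])
  have "1 * b < \<kappa> * b" using assms(2,5) by simp
  then have "1 < \<kappa>" using \<open>0 < b\<close> by (metis mult_less_cancel_right_pos)
  then show "\<bar>v u - (v b + v1 b * (u - b) + 0 * (u - b)\<^sup>2)\<bar> \<le> A * tangent_const \<mu> \<kappa> * b powr \<mu>"
    if "u \<in> {0..c}" for u
    using tangent_error[of b u \<kappa>] that assms by auto
qed (use assms in auto)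

lemma bound3_from:
  assumes "0 < a" "s \<in> {a<..<T}"
  shows "\<bar>v3 s\<bar> \<le> A * a powr (\<mu> - 3)"
proof -
  have "\<bar>v3 s\<bar> \<le> A * s powr (\<mu> - 3)" using assms by (intro bound3) auto
  also have "\<dots> \<le> A * a powr (\<mu> - 3)"
    using assms mu by (intro mult_left_mono powr_mono2' A_nonneg) auto
  finally show ?thesis .
qed

lemma quad_error:
  assumes "0 < a" "a < b" "b < c" "c \<le> T" "b - a \<le> \<rho> * (c - b)" "s \<in> {a..b}"
  shows "\<bar>v s - quad_interp v a b c s\<bar> \<le> (2 + \<rho>) * (A * a powr (\<mu> - 3) * (c - a) ^ 3)"
proof (rule quad_interp_error_le[where A = "v b" and D = "v1 b" and E = "v2 b / 2"])
  fix u assume u: "u \<in> {a..c}"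
  have "\<bar>v u - (v b + v1 b * (u - b) + v2 b / 2 * (u - b)\<^sup>2)\<bar> \<le> A * a powr (\<mu> - 3) * \<bar>u - b\<bar> ^ 3"
  proof (rule taylor_remainders(2)[where p = a and q = c])
    show "continuous_on {a..c} v" using assms by (intro continuous_on_subset[OF cont]) auto
  qed (use assms u A_nonneg in \<open>auto intro!: d1 d2 d3 bound3_from\<close>)
  also have "\<dots> \<le> A * a powr (\<mu> - 3) * (c - a) ^ 3"
    using u assms A_nonneg by (intro mult_left_mono power_mono) auto
  finally show "\<bar>v u - (v b + v1 b * (u - b) + v2 b / 2 * (u - b)\<^sup>2)\<bar> \<le> A * a powr (\<mu> - 3) * (c - a) ^ 3" .
qed (use assms in auto)

text \<open>Up to a remainder \<open>f\<close> of second order in the step,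
  \<open>deriv v s - m\<close> equals \<open>q * (s - (a + b) / 2)\<close>, and
  \<open>kernel_midpoint_orthogonal\<close> annihilates that term; without the cancellation only
  first order would be left.\<close>

lemma lin_piece:
  assumes "0 < a" "a < b" "b \<le> T" "0 < \<beta>" "\<beta> < 1" and z: "z = b - \<beta> / 2 * (b - a)"
  shows "(\<lambda>s. (z - s) powr (- \<beta>) * deriv v s) integrable_on {a..z}"
    and "\<bar>integral {a..z} (\<lambda>s. (z - s) powr (- \<beta>) * deriv v s)
        - integral {a..z} (\<lambda>s. (z - s) powr (- \<beta>) * deriv (lin_interp v a b) s)\<bar>
      \<le> 3 * A * a powr (\<mu> - 3) * (b - a)\<^sup>2 * ((b - a) powr (1 - \<beta>) / (1 - \<beta>))"
proof -
  define M where "M = A * a powr (\<mu> - 3)"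
  have M: "0 \<le> M" using A_nonneg by (simp add: M_def)
  have za: "z - a = (1 - \<beta> / 2) * (b - a)" "b - z = \<beta> / 2 * (b - a)"
    unfolding z by (simp_all add: field_simps)
  have "0 < z - a" "0 < b - z" unfolding za using assms by simp_all
  then have zab: "a < z" "z < b" by auto
  then have sub: "{a..z} \<subseteq> {0<..<T}" using \<open>0 < a\<close> \<open>b \<le> T\<close> by auto
  define m where "m = (v b - v a) / (b - a)"
  have dL: "deriv (lin_interp v a b) s = m" for s
    unfolding m_def using assms by (intro DERIV_imp_deriv DERIV_lin_interp) auto
  have "continuous_on {a..z} (\<lambda>s. deriv v s) = continuous_on {a..z} v1"
    using sub deriv_v by (intro continuous_on_cong) auto
  then have cv: "continuous_on {a..z} (\<lambda>s. deriv v s)" using continuous_on_v1[OF sub] by simp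
  have int: "(\<lambda>s. (z - s) powr (- \<beta>) * f s) integrable_on {a..z}" if "continuous_on {a..z} f" for f
  proof -
    have "bounded (f ` {a..z})" using that by (intro compact_imp_bounded compact_continuous_image) auto
    then obtain B where "\<forall>s\<in>{a..z}. \<bar>f s\<bar> \<le> B" by (auto simp: bounded_iff)
    then show ?thesis using that zab assms by (intro kernel_mult_bounded(1)[where B = B]) auto
  qed
  show iv: "(\<lambda>s. (z - s) powr (- \<beta>) * deriv v s) integrable_on {a..z}"
    by (rule int[OF cv])
  define q where "q = v2 z"
  define f where "f s = deriv v s - m - q * (s - (a + b) / 2)" for s
  have cf: "continuous_on {a..z} f" unfolding f_def by (intro continuous_intros cv)
  have mid: "((\<lambda>s. (z - s) powr (- \<beta>) * (q * (s - (a + b) / 2))) has_integral 0) {a..z}"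
    using has_integral_mult_right[OF kernel_midpoint_orthogonal[OF \<open>a < b\<close> \<open>0 < \<beta>\<close> \<open>\<beta> < 1\<close> z], of q]
    by (simp add: mult_ac)
  have rem: "\<bar>v1 s - (v1 z + v2 z * (s - z))\<bar> \<le> M * \<bar>s - z\<bar> ^ 2" if "s \<in> {a<..<b}" for s
    unfolding M_def
  proof (rule taylor_remainders(1)[where p = a and q = b])
    show "continuous_on {a..b} v" using assms by (intro continuous_on_subset[OF cont]) auto
  qed (use assms zab that A_nonneg in \<open>auto intro!: d1 d2 d3 bound3_from\<close>)
  have remv: "\<bar>v s - (v z + v1 z * (s - z) + v2 z / 2 * (s - z)\<^sup>2)\<bar> \<le> M * \<bar>s - z\<bar> ^ 3"
    if "s \<in> {a..b}" for s
    unfolding M_def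
  proof (rule taylor_remainders(2)[where p = a and q = b])
    show "continuous_on {a..b} v" using assms by (intro continuous_on_subset[OF cont]) auto
  qed (use assms zab that A_nonneg in \<open>auto intro!: d1 d2 d3 bound3_from\<close>)
  have Ra: "\<bar>v a - (v z + v1 z * (a - z) + q / 2 * (a - z)\<^sup>2)\<bar> \<le> M * (b - a) ^ 3"
    unfolding q_def using \<open>a < b\<close> zab
    by (intro order_trans[OF remv] mult_left_mono[OF _ M] power_mono) auto
  have Rb: "\<bar>v b - (v z + v1 z * (b - z) + q / 2 * (b - z)\<^sup>2)\<bar> \<le> M * (b - a) ^ 3"
    unfolding q_def using \<open>a < b\<close> zab
    by (intro order_trans[OF remv] mult_left_mono[OF _ M] power_mono) auto
  \<comment> \<open>The slope at the midpoint of the quadratic Taylor polynomial at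
    \<open>z\<close>. It equals the difference quotient of that polynomial over
    \<open>{a..b}\<close>, so \<open>m - c\<close> consists of the two end point remainders divided
    by \<open>b - a\<close>.\<close>
  define c where "c = v1 z + q * ((a + b) / 2 - z)"
  have "m * (b - a) = v b - v a" using assms by (simp add: m_def)
  moreover have "c * (b - a) = (v z + v1 z * (b - z) + q / 2 * (b - z)\<^sup>2) - (v z + v1 z * (a - z) + q / 2 * (a - z)\<^sup>2)"
    by (simp add: c_def field_simps power2_eq_square)
  ultimately have "\<bar>(m - c) * (b - a)\<bar> \<le> 2 * (M * (b - a) ^ 3)"
    using Ra Rb by (simp only: left_diff_distrib)
  then have "\<bar>m - c\<bar> * (b - a) \<le> 2 * M * (b - a)\<^sup>2 * (b - a)"
    using assms by (simp add: abs_mult power2_eq_square power3_eq_cube mult_ac)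
  then have mc: "\<bar>m - c\<bar> \<le> 2 * M * (b - a)\<^sup>2" using assms by simp
  have bf_interior: "\<bar>f s\<bar> \<le> 3 * M * (b - a)\<^sup>2" if "s \<in> {a<..<z}" for s
  proof -
    have "\<bar>v1 s - (v1 z + v2 z * (s - z))\<bar> \<le> M * (b - a)\<^sup>2"
      using that zab by (intro order_trans[OF rem] mult_left_mono[OF _ M] power_mono) auto
    moreover have "s \<in> {0<..<T}" using that \<open>0 < a\<close> \<open>b \<le> T\<close> zab by auto
    then have "f s = (v1 s - (v1 z + v2 z * (s - z))) - (m - c)"
      by (simp add: f_def c_def q_def deriv_v algebra_simps)
    ultimately show ?thesis using mc by linarith
  qed
  \<comment> \<open>The remainder of \<open>v1\<close> is controlled only inside
    \<open>{a<..<b}\<close>; continuity carries the bound to the end point \<open>a\<close>.\<close>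
  have bf: "\<bar>f s\<bar> \<le> 3 * M * (b - a)\<^sup>2" if "s \<in> {a..z}" for s
  proof (rule continuous_le_on_closure[where S = "{a<..<z}" and f = "\<lambda>s. \<bar>f s\<bar>"])
    have "closure {a<..<z} = {a..z}" using zab by simp
    then show "continuous_on (closure {a<..<z}) (\<lambda>s. \<bar>f s\<bar>)" "s \<in> closure {a<..<z}"
      using cf that by (auto intro: continuous_intros)
  qed (rule bf_interior)
  have "integral {a..z} (\<lambda>s. (z - s) powr (- \<beta>) * deriv v s)
        - integral {a..z} (\<lambda>s. (z - s) powr (- \<beta>) * deriv (lin_interp v a b) s)
      = integral {a..z} (\<lambda>s. (z - s) powr (- \<beta>) * deriv v s - (z - s) powr (- \<beta>) * m)"
    unfolding dL by (rule integral_diff[symmetric]) (auto intro!: int cv)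
  also have "\<dots> = integral {a..z} (\<lambda>s. (z - s) powr (- \<beta>) * f s + (z - s) powr (- \<beta>) * (q * (s - (a + b) / 2)))"
    by (simp add: f_def algebra_simps)
  also have "\<dots> = integral {a..z} (\<lambda>s. (z - s) powr (- \<beta>) * f s)"
    using integral_add[OF int[OF cf], of "\<lambda>s. (z - s) powr (- \<beta>) * (q * (s - (a + b) / 2))"] mid
    by (simp add: integral_unique has_integral_integrable)
  finally have "\<bar>integral {a..z} (\<lambda>s. (z - s) powr (- \<beta>) * deriv v s)
        - integral {a..z} (\<lambda>s. (z - s) powr (- \<beta>) * deriv (lin_interp v a b) s)\<bar>
      \<le> 3 * M * (b - a)\<^sup>2 * ((z - a) powr (1 - \<beta>) / (1 - \<beta>))"
    using kernel_mult_bounded(2)[of a z \<beta> f, OF _ \<open>\<beta> < 1\<close> cf bf] zab by simp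
  also have "\<dots> \<le> 3 * M * (b - a)\<^sup>2 * ((b - a) powr (1 - \<beta>) / (1 - \<beta>))"
    using zab assms M by (intro mult_left_mono divide_right_mono powr_mono2) auto
  finally show "\<bar>integral {a..z} (\<lambda>s. (z - s) powr (- \<beta>) * deriv v s)
        - integral {a..z} (\<lambda>s. (z - s) powr (- \<beta>) * deriv (lin_interp v a b) s)\<bar>
      \<le> 3 * A * a powr (\<mu> - 3) * (b - a)\<^sup>2 * ((b - a) powr (1 - \<beta>) / (1 - \<beta>))"
    by (simp add: M_def mult_ac)
qed

text \<open>The tangent at \<open>z\<close> is the yardstick: \<open>W\<close> bounds the deviation
  \<open>w\<close> from it on \<open>{0..b}\<close>, so the slope \<open>m\<close> of the
  interpolant differs from \<open>v1 z\<close> by at most \<open>2 * W / b\<close>. Left of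
  \<open>z / 2\<close> this controls values, right of it \<open>v1\<close> is Lipschitz because the
  origin is far away.\<close>

lemma lin_piece_first:
  assumes "0 < b" "b \<le> T" "0 < \<beta>" "\<beta> < 1" and z: "z = b - \<beta> / 2 * b"
  shows "(\<lambda>s. (z - s) powr (- \<beta>) * deriv v s) integrable_on {0..z}"
    and "\<bar>integral {0..z} (\<lambda>s. (z - s) powr (- \<beta>) * deriv v s)
        - integral {0..z} (\<lambda>s. (z - s) powr (- \<beta>) * deriv (lin_interp v 0 b) s)\<bar>
      \<le> (14 * A * tangent_const \<mu> 2 + 4 * A) / (1 - \<beta>) * z powr \<mu> * (z / 2) powr (- \<beta>)"
proof -
  \<comment> \<open>From \<open>\<beta> < 1\<close> one gets \<open>b \<le> 2 * z\<close>, so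
    \<open>tangent_error\<close> at \<open>z\<close> with factor 2 covers the whole interval
    \<open>{0..b}\<close>.\<close>
  have "\<beta> * b < b" "0 < \<beta> * b" using assms by simp_all
  moreover have "2 * z = b + (b - \<beta> * b)" by (simp add: z)
  ultimately have z0: "0 < z" "z < b" "b \<le> 2 * z" by linarith+
  have zT: "z \<in> {0<..<T}" using z0 \<open>b \<le> T\<close> by auto
  define W where "W = A * tangent_const \<mu> 2 * z powr \<mu>"
  define w where "w s = v s - (v z + v1 z * (s - z))" for s
  have w: "\<bar>w s\<bar> \<le> W" if "s \<in> {0..b}" for s
    using that tangent_error[OF zT, of s 2] z0 assms by (auto simp: w_def W_def)
  have W: "0 \<le> W" using w[of 0] assms by auto
  define m where "m = (v b - v 0) / b"
  have dL: "deriv (lin_interp v 0 b) s = m" for s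
    using DERIV_lin_interp[of 0 b v s] assms by (auto simp: m_def intro: DERIV_imp_deriv)
  have "w b - w 0 = v b - v 0 - v1 z * b" by (simp add: w_def algebra_simps)
  then have "m - v1 z = (w b - w 0) / b" using assms by (simp add: m_def diff_divide_distrib)
  then have "\<bar>m - v1 z\<bar> = \<bar>w b - w 0\<bar> / b" using assms by simp
  also have "\<dots> \<le> 2 * W / b" using w[of b] w[of 0] assms by (intro divide_right_mono) auto
  finally have mz: "\<bar>m - v1 z\<bar> \<le> 2 * W / b" .
  \<comment> \<open>This vanishes at 0 but in general not at \<open>z / 2\<close>, so a boundary
    term survives; it and the kernel difference contribute \<open>4 * W * k\<close> each.\<close>
  define g where "g s = v s - v 0 - m * s" for s
  have gb: "\<bar>g s\<bar> \<le> 4 * W" if "s \<in> {0..z/2}" for s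
  proof -
    have "g s = (w s - w 0) - (m - v1 z) * s" by (simp add: g_def w_def algebra_simps)
    moreover have "\<bar>(m - v1 z) * s\<bar> \<le> 2 * W / b * b"
      unfolding abs_mult using mz that z0 W by (intro mult_mono) auto
    ultimately show ?thesis using w[of s] w[of 0] that z0 by auto
  qed
  have cg: "continuous_on {0..z/2} g"
    unfolding g_def using zT by (intro continuous_intros continuous_on_subset[OF cont]) auto
  have dg: "(g has_real_derivative deriv v s - m) (at s)" if "s \<in> {0<..<z/2}" for s
    unfolding g_def using that zT
    by (auto intro!: derivative_eq_intros d1 simp: deriv_v)
  have h0: "0 \<le> z / 2" "z / 2 < z" using z0 by auto
  note i1 = kernel_by_parts(1)[OF h0 \<open>0 < \<beta>\<close> cg dg gb]
    and e1 = kernel_by_parts(2)[OF h0 \<open>0 < \<beta>\<close> cg dg gb]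
  define k where "k = (z / 2) powr (- \<beta>)"
  have k: "0 \<le> k" "z powr (- \<beta>) \<le> k" using z0 \<open>0 < \<beta>\<close> by (auto simp: k_def intro!: powr_mono2')
  have E1: "\<bar>integral {0..z/2} (\<lambda>s. (z - s) powr (- \<beta>) * (deriv v s - m))\<bar> \<le> 8 * W * k"
  proof -
    have "g 0 = 0" by (simp add: g_def)
    moreover have "\<bar>k * g (z/2)\<bar> \<le> k * (4 * W)"
      unfolding abs_mult using k gb[of "z/2"] z0 by (intro mult_mono) auto
    moreover have "4 * W * (k - z powr (- \<beta>)) \<le> 4 * W * k"
      using W by (intro mult_left_mono) auto
    ultimately show ?thesis using e1 by (simp add: k_def[symmetric] algebra_simps)
  qed
  have sub: "{z/2..z} \<subseteq> {0<..<T}" using zT by auto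
  have "continuous_on {z/2..z} (\<lambda>s. deriv v s - m) = continuous_on {z/2..z} (\<lambda>s. v1 s - m)"
    using sub deriv_v by (intro continuous_on_cong) auto
  then have cv: "continuous_on {z/2..z} (\<lambda>s. deriv v s - m)"
    using continuous_on_v1[OF sub] by (auto intro: continuous_intros)
  have b2: "\<bar>deriv v s - m\<bar> \<le> A * (z/2) powr (\<mu> - 2) * z + 2 * W / z" if s: "s \<in> {z/2..z}" for s
  proof -
    have "\<bar>v1 s - v1 z\<bar> \<le> A * (z/2) powr (\<mu> - 2) * \<bar>s - z\<bar> ^ Suc 0"
    proof (rule abs_le_power_integrate[where g' = v2])
      show "continuous_on {min z s..max z s} (\<lambda>s. v1 s - v1 z)"
        using s sub by (intro continuous_intros continuous_on_v1) auto
      fix u assume u: "min z s < u" "u < max z s"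
      then have uT: "u \<in> {0<..<T}" "z/2 \<le> u" using s sub zT z0 by auto
      then show "((\<lambda>s. v1 s - v1 z) has_real_derivative v2 u) (at u)"
        by (auto intro!: derivative_eq_intros d2)
      have "\<bar>v2 u\<bar> \<le> A * u powr (\<mu> - 2)" using uT by (intro bound2)
      also have "\<dots> \<le> A * (z/2) powr (\<mu> - 2)"
        using uT z0 mu A_nonneg by (intro mult_left_mono powr_mono2') auto
      finally show "\<bar>v2 u\<bar> \<le> A * (z/2) powr (\<mu> - 2) * \<bar>u - z\<bar> ^ 0" by simp
    qed (use A_nonneg in auto)
    also have "\<dots> \<le> A * (z/2) powr (\<mu> - 2) * z"
      using s z0 A_nonneg by (intro mult_left_mono) auto
    finally have "\<bar>v1 s - v1 z\<bar> \<le> A * (z/2) powr (\<mu> - 2) * z" .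
    moreover have "deriv v s = v1 s" using s sub by (intro deriv_v) auto
    moreover have "2 * W / b \<le> 2 * W / z" using W z0 by (intro divide_left_mono) auto
    ultimately show ?thesis using mz by linarith
  qed
  have h1: "z / 2 \<le> z" using z0 by simp
  note i2 = kernel_mult_bounded(1)[OF h1 \<open>\<beta> < 1\<close> cv b2]
    and e2 = kernel_mult_bounded(2)[OF h1 \<open>\<beta> < 1\<close> cv b2]
  have E2: "\<bar>integral {z/2..z} (\<lambda>s. (z - s) powr (- \<beta>) * (deriv v s - m))\<bar>
      \<le> (4 * A * z powr \<mu> + 2 * W) * k / (1 - \<beta>)"
  proof -
    have "(z/2) powr (1 - \<beta>) = (z/2) * k"
      using powr_add[of "z/2" 1 "- \<beta>"] z0 by (simp add: k_def)
    have p: "(z/2) powr (\<mu> - 2) * z * z \<le> 4 * z powr \<mu>"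
    proof -
      have "(z/2) powr (\<mu> - 2) * z * z = 4 * ((z/2) powr (\<mu> - 2) * (z/2) powr 2)"
        using z0 by (simp add: power2_eq_square)
      also have "\<dots> = 4 * (z/2) powr \<mu>" using z0 by (simp only: powr_add[symmetric]) simp
      also have "\<dots> \<le> 4 * z powr \<mu>" using z0 mu by (auto intro!: powr_mono2)
      finally show ?thesis .
    qed
    have "(A * (z/2) powr (\<mu> - 2) * z + 2 * W / z) * ((z - z/2) powr (1 - \<beta>) / (1 - \<beta>))
      = (A * ((z/2) powr (\<mu> - 2) * z * z) + 2 * W) / 2 * k / (1 - \<beta>)"
    proof -
      have "(A * (z/2) powr (\<mu> - 2) * z + 2 * W / z) * z = A * ((z/2) powr (\<mu> - 2) * z * z) + 2 * W"
        using z0 by (simp add: distrib_right)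
      moreover have "z - z/2 = z/2" by simp
      then have "(z - z/2) powr (1 - \<beta>) = (z/2) * k" using \<open>(z/2) powr (1 - \<beta>) = (z/2) * k\<close> by simp
      ultimately show ?thesis by (simp only: times_divide_eq_left times_divide_eq_right mult.assoc[symmetric])
    qed
    also have "\<dots> \<le> (A * (4 * z powr \<mu>) + 2 * W) * k / (1 - \<beta>)"
    proof (intro divide_right_mono mult_right_mono)
      have halve: "(x + 2 * w) / 2 \<le> y + 2 * w" if "x \<le> y" "0 \<le> y" "0 \<le> w" for x y w :: real
        using that by simp
      have "A * ((z/2) powr (\<mu> - 2) * z * z) \<le> A * (4 * z powr \<mu>)"
        by (rule mult_left_mono[OF p A_nonneg])
      moreover have "0 \<le> A * (4 * z powr \<mu>)" using A_nonneg by simp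
      ultimately show "(A * ((z/2) powr (\<mu> - 2) * z * z) + 2 * W) / 2 \<le> A * (4 * z powr \<mu>) + 2 * W"
        using W halve by blast
    qed (use k assms in auto)
    finally show ?thesis using e2 by (simp add: mult_ac)
  qed
  have half: "0 \<le> z/2" "z/2 \<le> z" using z0 by auto
  have i: "(\<lambda>s. (z - s) powr (- \<beta>) * (deriv v s - m)) integrable_on {0..z}"
    using i1 i2 by (intro Henstock_Kurzweil_Integration.integrable_combine[OF half]) blast+
  have E: "\<bar>integral {0..z} (\<lambda>s. (z - s) powr (- \<beta>) * (deriv v s - m))\<bar>
      \<le> (14 * A * tangent_const \<mu> 2 + 4 * A) / (1 - \<beta>) * z powr \<mu> * k"
  proof -
    have "8 * W * k * (1 - \<beta>) \<le> 8 * W * k * 1"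
      using W k assms by (intro mult_left_mono) auto
    then have "8 * W * k \<le> 8 * W * k / (1 - \<beta>)" using assms by (simp add: le_divide_eq)
    moreover have "0 \<le> 4 * W * k / (1 - \<beta>)" using W k assms by simp
    \<comment> \<open>The coefficient is 14 = 8 + 2 + 4: the first two come from the left and right
      halves, the 4 only rounds the constant up.\<close>
    moreover have "8 * W * k / (1 - \<beta>) + (4 * A * z powr \<mu> + 2 * W) * k / (1 - \<beta>) + 4 * W * k / (1 - \<beta>)
       = (14 * A * tangent_const \<mu> 2 + 4 * A) / (1 - \<beta>) * z powr \<mu> * k"
    proof -
      have "8 * W * k + (4 * A * z powr \<mu> + 2 * W) * k + 4 * W * k
        = (14 * A * tangent_const \<mu> 2 + 4 * A) * z powr \<mu> * k"
        unfolding W_def by (simp only: algebra_simps)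
      then show ?thesis by (simp add: add_divide_distrib[symmetric])
    qed
    ultimately show ?thesis using E1 E2 Henstock_Kurzweil_Integration.integral_combine[OF half i] by linarith
  qed
  have "((\<lambda>s. (z - s) powr (- \<beta>)) has_integral (z - 0) powr (- \<beta> + 1) / (- \<beta> + 1)) {0..z}"
    using z0 assms by (intro kernel_has_integral) auto
  then have im: "(\<lambda>s. (z - s) powr (- \<beta>) * m) integrable_on {0..z}"
    by (auto intro: integrable_on_mult_left)
  have "(\<lambda>s. (z - s) powr (- \<beta>) * (deriv v s - m) + (z - s) powr (- \<beta>) * m) integrable_on {0..z}"
    by (rule integrable_add[OF i im])
  then show iv: "(\<lambda>s. (z - s) powr (- \<beta>) * deriv v s) integrable_on {0..z}"
    by (simp add: algebra_simps)
  show "\<bar>integral {0..z} (\<lambda>s. (z - s) powr (- \<beta>) * deriv v s)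
        - integral {0..z} (\<lambda>s. (z - s) powr (- \<beta>) * deriv (lin_interp v 0 b) s)\<bar>
      \<le> (14 * A * tangent_const \<mu> 2 + 4 * A) / (1 - \<beta>) * z powr \<mu> * (z / 2) powr (- \<beta>)"
    using E integral_diff[OF iv im] unfolding dL k_def by (simp add: right_diff_distrib)
qed

end

section \<open>Sums over graded meshes\<close>

lemma neg_power_diff_le:
  fixes a b \<beta> :: real
  assumes "0 < a" "a \<le> b" "0 < \<beta>"
  shows "a powr (- \<beta>) - b powr (- \<beta>) \<le> \<beta> * (b - a) * a powr (- \<beta> - 1)"
proof (cases "a = b")
  case False
  then have "a < b" using assms by simp
  moreover have "((\<lambda>s. s powr (- \<beta>)) has_real_derivative - \<beta> * u powr (- \<beta> - 1)) (at u)"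
    if "a \<le> u" for u
    using that assms by (auto intro!: derivative_eq_intros)
  ultimately obtain u where u: "a < u" "b powr (- \<beta>) - a powr (- \<beta>) = (b - a) * (- \<beta> * u powr (- \<beta> - 1))"
    using MVT2[of a b "\<lambda>s. s powr (- \<beta>)" "\<lambda>u. - \<beta> * u powr (- \<beta> - 1)"] by blast
  have "a powr (- \<beta>) - b powr (- \<beta>) = \<beta> * (b - a) * u powr (- \<beta> - 1)" using u(2) by (simp add: algebra_simps)
  also have "\<dots> \<le> \<beta> * (b - a) * a powr (- \<beta> - 1)"
    using u(1) assms by (intro mult_left_mono powr_mono2') auto
  finally show ?thesis .
qed (use assms in auto)

text \<open>The absolute value makes one constant serve both signs of \<open>p\<close>; exponents
  such as \<open>3 / r - \<mu>\<close> have no fixed sign.\<close>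

lemma powr_le_of_ratio:
  fixes a b M p :: real
  assumes "0 < a" "a \<le> b" "b \<le> M * a" "1 \<le> M"
  shows "b powr p \<le> M powr \<bar>p\<bar> * a powr p" "a powr p \<le> M powr \<bar>p\<bar> * b powr p"
proof -
  have r: "b / a \<le> M" "1 \<le> b / a" using assms by (auto simp: field_simps)
  have 1: "(b / a) powr q \<le> M powr \<bar>p\<bar>" if "\<bar>q\<bar> = \<bar>p\<bar>" for q
  proof -
    have "(b / a) powr q \<le> (b / a) powr \<bar>p\<bar>" using r that by (intro powr_mono) auto
    also have "\<dots> \<le> M powr \<bar>p\<bar>" using r by (intro powr_mono2) auto
    finally show ?thesis .
  qed
  have "b powr p = (b / a) powr p * a powr p" using assms by (simp add: powr_divide)
  also have "\<dots> \<le> M powr \<bar>p\<bar> * a powr p" by (intro mult_right_mono 1) auto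
  finally show "b powr p \<le> M powr \<bar>p\<bar> * a powr p" .
  have "a powr p = (b / a) powr (- p) * b powr p"
    using assms by (simp add: powr_divide powr_minus field_simps)
  also have "\<dots> \<le> M powr \<bar>p\<bar> * b powr p" by (intro mult_right_mono 1) auto
  finally show "a powr p \<le> M powr \<bar>p\<bar> * b powr p" .
qed

text \<open>The weights \<open>(x 1 / x k) powr (3 / r - \<mu>)\<close> are summed after lowering the exponent to a value that
  is never \<open>1\<close>, so that the borderline logarithm does not appear; the slack \<open>\<beta> / r\<close> between the
  exponents \<open>3 / r\<close> and \<open>(3 - \<beta>) / r\<close> leaves room for this.\<close>

definition aux_exponent :: "real \<Rightarrow> real \<Rightarrow> real \<Rightarrow> real" where
  "aux_exponent r \<beta> \<mu> =
     (if 1 + \<beta> \<le> (3 - \<beta>) / r - \<mu> + \<beta> then 3 / r - \<mu> else (3 - \<beta>) / r - \<mu>)"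

text \<open>The first summand belongs to nodes with \<open>x n \<le> 2 * x k\<close>, the second to
  the others, for which \<open>z n - x k\<close> is at least
  \<open>x n * ((1 - \<beta>) / 2)\<close>.\<close>

definition interior_const :: "real \<Rightarrow> real \<Rightarrow> real \<Rightarrow> real \<Rightarrow> real" where
  "interior_const r \<kappa> \<beta> \<mu> =
     2 powr \<bar>3 / r - \<mu>\<bar> * (2 * \<kappa>) powr \<beta>
     + \<beta> * ((1 - \<beta>) / 2) powr (- \<beta> - 1)
       * (\<kappa> powr \<bar>aux_exponent r \<beta> \<mu>\<bar> / \<bar>1 - aux_exponent r \<beta> \<mu>\<bar>)"

text \<open>A single member of the family. Because \<open>x 0 = 0\<close>, the first node
  \<open>x 1\<close> doubles as the first step. The law comparing nodes with powers of the index
  enters through the neighbour ratio.\<close>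

locale graded_mesh =
  fixes r \<kappa> T \<beta> :: real and N :: nat and x :: "nat \<Rightarrow> real"
  assumes r: "1 \<le> r" and kappa: "1 \<le> \<kappa>" and beta: "0 < \<beta>" "\<beta> < 1"
    and mesh: "mesh T N x"
    and step_upper: "\<And>n. 1 \<le> n \<Longrightarrow> n \<le> N \<Longrightarrow>
          step x n \<le> \<kappa> * (x 1 powr (1 / r) * x n powr (1 - 1 / r))"
    and step_lower: "\<And>n. 1 \<le> n \<Longrightarrow> n \<le> N \<Longrightarrow>
          x 1 powr (1 / r) * x n powr (1 - 1 / r) \<le> \<kappa> * step x n"
    and ratio: "\<And>n. 1 \<le> n \<Longrightarrow> Suc n \<le> N \<Longrightarrow> x (Suc n) \<le> \<kappa> * x n"
begin

lemma x0: "x 0 = 0" and xN: "x N = T"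
  using mesh by (auto simp: mesh_def)

lemma x_less: "m < n \<Longrightarrow> n \<le> N \<Longrightarrow> x m < x n"
proof (induction n)
  case (Suc n)
  have "x n < x (Suc n)" using mesh Suc.prems by (auto simp: mesh_def)
  then show ?case using Suc by (cases "m = n") auto
qed simp

lemma x_le: "m \<le> n \<Longrightarrow> n \<le> N \<Longrightarrow> x m \<le> x n"
  using x_less[of m n] by (cases "m = n") auto

lemma x_pos: "1 \<le> n \<Longrightarrow> n \<le> N \<Longrightarrow> 0 < x n"
  using x_less[of 0 n] x0 by simp

lemma x_le_T: "n \<le> N \<Longrightarrow> x n \<le> T"
  using x_le[of n N] xN by simp

lemma step_pos: "1 \<le> n \<Longrightarrow> n \<le> N \<Longrightarrow> 0 < step x n"
  using x_less[of "n - 1" n] by (simp add: step_def)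

lemma step_one: "step x 1 = x 1"
  by (simp add: step_def x0)

definition z :: "nat \<Rightarrow> real" where
  "z n = x n - \<beta> / 2 * step x n"

lemma z_bounds:
  assumes "1 \<le> n" "n \<le> N"
  shows "x (n - 1) + step x n / 2 \<le> z n" "x n * (1 - \<beta> / 2) \<le> z n" "z n < x n"
proof -
  have s: "0 < step x n" "step x n \<le> x n"
    using step_pos[OF assms] x_le[of 0 "n - 1"] x0 assms by (auto simp: step_def)
  have "\<beta> * step x n \<le> 1 * step x n" using beta s by (intro mult_right_mono) auto
  moreover have "x n = x (n - 1) + step x n" by (simp add: step_def)
  ultimately show "x (n - 1) + step x n / 2 \<le> z n" unfolding z_def times_divide_eq_left by linarith
  have "\<beta> * step x n \<le> \<beta> * x n" using beta s by (intro mult_left_mono) auto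
  then show "x n * (1 - \<beta> / 2) \<le> z n" by (simp add: z_def algebra_simps)
  show "z n < x n" using beta s by (simp add: z_def)
qed

lemma x_less_z:
  assumes "m < n" "n \<le> N"
  shows "x m < z n"
proof -
  have "m \<le> n - 1" "n - 1 \<le> N" "1 \<le> n" using assms by auto
  then show ?thesis
    using z_bounds(1)[of n] x_le[of m "n - 1"] step_pos[of n] assms by linarith
qed

lemma grading_mono:
  assumes "1 \<le> m" "m \<le> n" "n \<le> N"
  shows "x 1 powr (1 / r) * x m powr (1 - 1 / r) \<le> x 1 powr (1 / r) * x n powr (1 - 1 / r)"
  using assms r x_le[of m n] x_pos[of m] by (intro mult_left_mono powr_mono2) auto

text \<open>Supplies the ratio \<open>\<rho> = \<kappa>\<^sup>2\<close> demanded by the bounds for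
  quadratic interpolation; \<open>r \<ge> 1\<close> makes the grading function increasing.\<close>

lemma step_le_next:
  assumes "1 \<le> n" "Suc n \<le> N"
  shows "step x n \<le> \<kappa>\<^sup>2 * step x (Suc n)"
proof -
  have "step x n \<le> \<kappa> * (x 1 powr (1 / r) * x n powr (1 - 1 / r))"
    using assms by (intro step_upper) auto
  also have "\<dots> \<le> \<kappa> * (x 1 powr (1 / r) * x (Suc n) powr (1 - 1 / r))"
    using assms kappa by (intro mult_left_mono grading_mono) auto
  also have "\<dots> \<le> \<kappa> * (\<kappa> * step x (Suc n))"
    using assms kappa by (intro mult_left_mono step_lower) auto
  finally show ?thesis by (simp add: power2_eq_square mult.assoc)
qed

lemma next_step_le:
  assumes "1 \<le> n" "Suc n \<le> N"
  shows "step x (Suc n) \<le> \<kappa> ^ 3 * step x n"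
proof -
  have "x (Suc n) powr (1 - 1 / r) \<le> (\<kappa> * x n) powr (1 - 1 / r)"
    using assms r x_pos[of "Suc n"] by (intro powr_mono2 ratio) auto
  also have "\<dots> = \<kappa> powr (1 - 1 / r) * x n powr (1 - 1 / r)"
    using kappa x_pos[of n] assms by (simp add: powr_mult)
  also have "\<dots> \<le> \<kappa> powr 1 * x n powr (1 - 1 / r)"
    using kappa r by (intro mult_right_mono powr_mono) auto
  finally have *: "x (Suc n) powr (1 - 1 / r) \<le> \<kappa> * x n powr (1 - 1 / r)" using kappa by simp
  have "step x (Suc n) \<le> \<kappa> * (x 1 powr (1 / r) * x (Suc n) powr (1 - 1 / r))"
    using assms by (intro step_upper) auto
  also have "\<dots> \<le> \<kappa> * (x 1 powr (1 / r) * (\<kappa> * x n powr (1 - 1 / r)))"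
    using kappa * by (intro mult_left_mono) auto
  also have "\<dots> = \<kappa> * (\<kappa> * (x 1 powr (1 / r) * x n powr (1 - 1 / r)))" by simp
  also have "\<dots> \<le> \<kappa> * (\<kappa> * (\<kappa> * step x n))"
    using assms kappa by (intro mult_left_mono step_lower) auto
  finally show ?thesis by (simp add: power3_eq_cube mult.assoc)
qed

lemma ratio_powr_mono:
  assumes "1 \<le> n" "n \<le> N" "p \<le> q"
  shows "(x 1 / x n) powr q \<le> (x 1 / x n) powr p"
  using assms x_le[of 1 n] x_pos[of 1] x_pos[of n] by (intro powr_mono') auto

text \<open>A right-end Riemann sum for \<open>s powr (- p)\<close>, compared with the integral
  through the neighbour ratio; it starts at \<open>k = 2\<close> to stay away from 0. For
  \<open>p < 1\<close> the upper limit \<open>x n\<close> dominates, for \<open>p > 1\<close> the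
  lower limit \<open>x 1\<close>; the exponent \<open>min 1 p - 1\<close> records both
  cases.\<close>

lemma sum_step_powr_le:
  assumes "n \<le> N" "p \<noteq> 1" "2 \<le> n"
  shows "(\<Sum>k=2..<n. step x k * (x 1 / x k) powr p)
    \<le> \<kappa> powr \<bar>p\<bar> / \<bar>1 - p\<bar> * (x 1 * (x 1 / x n) powr (min 1 p - 1))"
proof -
  define F where "F s = s powr (1 - p) / (1 - p)" for s :: real
  have k: "step x k * x k powr (- p) \<le> \<kappa> powr \<bar>p\<bar> * (F (x k) - F (x (k - 1)))"
    if k: "2 \<le> k" "k < n" for k
  proof -
    have pos: "0 < x (k - 1)" "x (k - 1) < x k"
      using k assms x_pos[of "k - 1"] x_less[of "k - 1" k] by auto
    have "(F has_real_derivative u powr (- p)) (at u)" if "x (k - 1) \<le> u" for u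
      unfolding F_def using that pos assms by (auto intro!: derivative_eq_intros)
    then obtain u where u: "x (k - 1) < u" "u < x k"
      "F (x k) - F (x (k - 1)) = (x k - x (k - 1)) * u powr (- p)"
      using MVT2[OF pos(2), of F "\<lambda>u. u powr (- p)"] by blast
    have "x k \<le> \<kappa> * x (k - 1)" using ratio[of "k - 1"] k assms by simp
    also have "\<dots> \<le> \<kappa> * u" using u kappa by (intro mult_left_mono) auto
    finally have "x k powr (- p) \<le> \<kappa> powr \<bar>- p\<bar> * u powr (- p)"
      using u pos kappa by (intro powr_le_of_ratio) auto
    then have "step x k * x k powr (- p) \<le> step x k * (\<kappa> powr \<bar>p\<bar> * u powr (- p))"
      using pos by (intro mult_left_mono) (auto simp: step_def)
    then show ?thesis using u(3) by (simp add: step_def mult_ac)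
  qed
  have "(\<Sum>k=2..<n. step x k * x k powr (- p)) \<le> (\<Sum>k=2..<n. \<kappa> powr \<bar>p\<bar> * (F (x k) - F (x (k - 1))))"
    by (intro sum_mono k) auto
  also have "\<dots> = \<kappa> powr \<bar>p\<bar> * (\<Sum>k=2..<n. F (x k) - F (x (k - 1)))"
    by (simp add: sum_distrib_left)
  also have "(\<Sum>k=2..<n. F (x k) - F (x (k - 1))) = F (x (n - 1)) - F (x 1)"
    using \<open>2 \<le> n\<close>
  proof (induction n rule: dec_induct)
    case (step m)
    then show ?case by (simp add: sum.atLeastLessThan_Suc)
  qed simp
  also have "F (x (n - 1)) - F (x 1) \<le> (x 1 powr (- p) * (x 1 * (x 1 / x n) powr (min 1 p - 1))) / \<bar>1 - p\<bar>"
  proof -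
    have pos: "0 < x 1" "0 < x (n - 1)" "x (n - 1) \<le> x n" "0 < x n"
      using assms x_pos[of 1] x_pos[of "n - 1"] x_le[of "n - 1" n] x_pos[of n] by auto
    show ?thesis
    proof (cases "p < 1")
      case True
      have "x 1 powr (- p) * (x 1 * (x 1 / x n) powr (min 1 p - 1)) = x n powr (1 - p)"
        using True pos by (simp add: powr_divide powr_minus powr_diff field_simps)
      moreover have "x (n - 1) powr (1 - p) \<le> x n powr (1 - p)"
        using True pos by (intro powr_mono2) auto
      then have "x (n - 1) powr (1 - p) - x 1 powr (1 - p) \<le> x n powr (1 - p)"
        using powr_ge_zero[of "x 1" "1 - p"] by linarith
      then have "(x (n - 1) powr (1 - p) - x 1 powr (1 - p)) / \<bar>1 - p\<bar> \<le> x n powr (1 - p) / \<bar>1 - p\<bar>"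
        by (rule divide_right_mono) simp
      moreover have "F (x (n - 1)) - F (x 1) = (x (n - 1) powr (1 - p) - x 1 powr (1 - p)) / \<bar>1 - p\<bar>"
        using True by (simp add: F_def diff_divide_distrib)
      ultimately show ?thesis by (simp only:)
    next
      case False
      then have p: "1 < p" using assms by simp
      have "x 1 powr (- p) * (x 1 * (x 1 / x n) powr (min 1 p - 1)) = x 1 powr (1 - p)"
        using p pos by (simp add: powr_diff powr_minus field_simps)
      moreover have "F (x (n - 1)) - F (x 1) = (x 1 powr (1 - p) - x (n - 1) powr (1 - p)) / (p - 1)"
        using minus_divide_divide[of "x 1 powr (1 - p) - x (n - 1) powr (1 - p)" "p - 1"]
        by (simp add: F_def diff_divide_distrib)
      ultimately show ?thesis using p by (simp add: divide_right_mono)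
    qed
  qed
  finally have "(\<Sum>k=2..<n. step x k * x k powr (- p))
    \<le> \<kappa> powr \<bar>p\<bar> * (x 1 powr (- p) * (x 1 * (x 1 / x n) powr (min 1 p - 1)) / \<bar>1 - p\<bar>)"
    by (simp add: mult_left_mono)
  then have "x 1 powr p * (\<Sum>k=2..<n. step x k * x k powr (- p))
    \<le> x 1 powr p * (\<kappa> powr \<bar>p\<bar> * (x 1 powr (- p) * (x 1 * (x 1 / x n) powr (min 1 p - 1)) / \<bar>1 - p\<bar>))"
    by (intro mult_left_mono) auto
  also have "\<dots> = (x 1 powr p * x 1 powr (- p)) * (\<kappa> powr \<bar>p\<bar> / \<bar>1 - p\<bar> * (x 1 * (x 1 / x n) powr (min 1 p - 1)))"
    by simp
  also have "x 1 powr p * x 1 powr (- p) = 1"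
    using x_pos[of 1] assms by (simp add: powr_add[symmetric])
  also have "x 1 powr p * (\<Sum>k=2..<n. step x k * x k powr (- p)) = (\<Sum>k=2..<n. step x k * (x 1 / x k) powr p)"
    unfolding sum_distrib_left
  proof (intro sum.cong refl)
    fix k assume "k \<in> {2..<n}"
    then have "0 < x 1" "0 < x k" using x_pos[of 1] x_pos[of k] assms by auto
    then show "x 1 powr p * (step x k * x k powr - p) = step x k * (x 1 / x k) powr p"
      by (simp add: powr_divide powr_minus field_simps)
  qed
  finally show ?thesis by simp
qed

text \<open>The sum telescopes to at most its last kernel value, taken at distance
  \<open>z n - x (n - 1)\<close>. That distance is at least half a step, and the grading bounds the
  step from below.\<close>

lemma kernel_sum_le:
  assumes "2 \<le> n" "n \<le> N"
  shows "(\<Sum>k=2..<n. (z n - x k) powr (- \<beta>) - (z n - x (k - 1)) powr (- \<beta>))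
    \<le> (2 * \<kappa>) powr \<beta> * (x 1 powr (- \<beta>) * (x 1 / x n) powr (\<beta> - \<beta> / r))"
proof -
  have "(\<Sum>k=2..<m. (z n - x k) powr (- \<beta>) - (z n - x (k - 1)) powr (- \<beta>))
      = (z n - x (m - 1)) powr (- \<beta>) - (z n - x 1) powr (- \<beta>)" if "2 \<le> m" for m
    using that
  proof (induction m rule: dec_induct)
    case (step m)
    then show ?case by (simp add: sum.atLeastLessThan_Suc)
  qed simp
  then have "(\<Sum>k=2..<n. (z n - x k) powr (- \<beta>) - (z n - x (k - 1)) powr (- \<beta>))
      \<le> (z n - x (n - 1)) powr (- \<beta>)" using assms by simp
  also have "\<dots> \<le> (x 1 powr (1 / r) * x n powr (1 - 1 / r) / (2 * \<kappa>)) powr (- \<beta>)"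
  proof (rule powr_mono2')
    have "x 1 powr (1 / r) * x n powr (1 - 1 / r) / (2 * \<kappa>) \<le> step x n / 2"
      using step_lower[of n] kappa assms by (simp add: field_simps)
    also have "\<dots> \<le> z n - x (n - 1)" using z_bounds(1)[of n] assms by simp
    finally show "x 1 powr (1 / r) * x n powr (1 - 1 / r) / (2 * \<kappa>) \<le> z n - x (n - 1)" .
  qed (use beta kappa x_pos[of 1] x_pos[of n] assms in auto)
  also have "\<dots> = (2 * \<kappa>) powr \<beta> * (x 1 powr (- \<beta>) * (x 1 / x n) powr (\<beta> - \<beta> / r))"
  proof -
    have "0 < x 1" "0 < x n" "0 < \<kappa>" using x_pos[of 1] x_pos[of n] assms kappa by auto
    then show ?thesis
      by (simp add: powr_def ln_div ln_mult exp_add[symmetric] algebra_simps diff_divide_distrib add_divide_distrib)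
  qed
  finally show ?thesis .
qed

text \<open>Where \<open>x n \<le> 2 * x k\<close>, the weight is comparable with its value at
  \<open>n\<close>, and the kernel sum raises the exponent \<open>q\<close> to \<open>e\<close>.
  Elsewhere the kernel is smooth on the scale \<open>x n\<close>, so \<open>J k\<close> is at most a
  multiple of \<open>x n powr (- \<beta> - 1) * step x k\<close>, and the sum of weighted steps
  gives the exponent \<open>\<beta> + min 1 p\<close>.\<close>

lemma interior_sum_le:
  assumes "2 \<le> n" "n \<le> N"
  shows "(\<Sum>k=2..<n. (x 1 / x k) powr (3 / r - \<mu>) * ((z n - x k) powr (- \<beta>) - (z n - x (k - 1)) powr (- \<beta>)))
    \<le> interior_const r \<kappa> \<beta> \<mu> * (x 1 powr (- \<beta>) * (x 1 / x n) powr (min (1 + \<beta>) ((3 - \<beta>) / r - \<mu> + \<beta>)))"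
proof -
  define q where "q = 3 / r - \<mu>"
  define e where "e = (3 - \<beta>) / r - \<mu> + \<beta>"
  define p where "p = aux_exponent r \<beta> \<mu>"
  define J where "J k = (z n - x k) powr (- \<beta>) - (z n - x (k - 1)) powr (- \<beta>)" for k
  define c where "c = \<beta> * ((1 - \<beta>) / 2) powr (- \<beta> - 1)"
  have qe: "q = e - \<beta> + \<beta> / r" using r by (simp add: q_def e_def field_simps)
  have br: "0 < \<beta> / r" using beta r by simp
  \<comment> \<open>If \<open>1 + \<beta> \<le> e\<close>, then
    \<open>p = q \<ge> 1 + \<beta> / r > 1\<close>; otherwise \<open>p = e - \<beta> < 1\<close>.
    Both branches avoid 1 and give the required minimum.\<close>
  have p: "p \<noteq> 1" "p \<le> q" "\<beta> + min 1 p = min (1 + \<beta>) e"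
    using qe br unfolding p_def aux_exponent_def e_def[symmetric] q_def[symmetric]
    by (auto simp: e_def min_def)
  have pos: "0 < x 1" "0 < x n" using x_pos[of 1] x_pos[of n] assms by auto
  have J: "0 \<le> J k" if "2 \<le> k" "k < n" for k
    using x_less_z[of k n] x_le[of "k - 1" k] that assms beta unfolding J_def
    by (auto intro!: powr_mono2')
  \<comment> \<open>Each node is charged both bounds at once, so the index set never has to be split
    at \<open>x n / 2\<close>.\<close>
  have k: "(x 1 / x k) powr q * J k \<le> 2 powr \<bar>q\<bar> * (x 1 / x n) powr q * J k
      + c * x n powr (- \<beta> - 1) * (step x k * (x 1 / x k) powr p)" (is "_ \<le> ?a + ?b")
    if k: "2 \<le> k" "k < n" for k
  proof -
    have xk: "0 < x k" "x k \<le> x n" using x_pos[of k] x_le[of k n] k assms by auto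
    have a: "0 \<le> ?a" using J[OF k] by simp
    have b: "0 \<le> ?b" using step_pos[of k] k assms beta by (simp add: c_def)
    show ?thesis
    proof (cases "x n \<le> 2 * x k")
      case True
      have "x k powr (- q) \<le> 2 powr \<bar>- q\<bar> * x n powr (- q)"
        using powr_le_of_ratio(2)[OF xk True, of "- q"] by simp
      then have "x 1 powr q * x k powr (- q) \<le> x 1 powr q * (2 powr \<bar>q\<bar> * x n powr (- q))"
        by (intro mult_left_mono) auto
      then have "(x 1 / x k) powr q \<le> 2 powr \<bar>q\<bar> * (x 1 / x n) powr q"
        using pos xk by (simp add: powr_divide powr_minus field_simps)
      then have "(x 1 / x k) powr q * J k \<le> ?a" using J[OF k] by (rule mult_right_mono)
      then show ?thesis using b by linarith
    next
      case False
      have "x n * ((1 - \<beta>) / 2) \<le> z n - x k"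
      proof -
        have "x n * (1 - \<beta> / 2) \<le> z n" using assms by (intro z_bounds) auto
        moreover have "x n * ((1 - \<beta>) / 2) = x n * (1 - \<beta> / 2) - x n / 2" by (simp add: field_simps)
        ultimately show ?thesis using False by linarith
      qed
      then have "(z n - x k) powr (- \<beta> - 1) \<le> (x n * ((1 - \<beta>) / 2)) powr (- \<beta> - 1)"
        using pos beta by (intro powr_mono2') auto
      also have "\<dots> = ((1 - \<beta>) / 2) powr (- \<beta> - 1) * x n powr (- \<beta> - 1)"
        by (subst powr_mult) (use pos beta in auto)
      finally have 1: "(z n - x k) powr (- \<beta> - 1) \<le> ((1 - \<beta>) / 2) powr (- \<beta> - 1) * x n powr (- \<beta> - 1)" .
      have "J k \<le> \<beta> * (z n - x (k - 1) - (z n - x k)) * (z n - x k) powr (- \<beta> - 1)"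
        unfolding J_def using x_less_z[of k n] x_le[of "k - 1" k] k assms beta
        by (intro neg_power_diff_le) auto
      also have "z n - x (k - 1) - (z n - x k) = step x k" by (simp add: step_def)
      also have "\<beta> * step x k * (z n - x k) powr (- \<beta> - 1)
          \<le> \<beta> * step x k * (((1 - \<beta>) / 2) powr (- \<beta> - 1) * x n powr (- \<beta> - 1))"
        using 1 beta step_pos[of k] k assms by (intro mult_left_mono) auto
      also have "\<dots> = c * x n powr (- \<beta> - 1) * step x k" by (simp add: c_def)
      finally have Jk: "J k \<le> c * x n powr (- \<beta> - 1) * step x k" .
      have "(x 1 / x k) powr q * J k \<le> (x 1 / x k) powr p * (c * x n powr (- \<beta> - 1) * step x k)"
        using J[OF k] Jk p ratio_powr_mono[of k p q] k assms by (intro mult_mono) auto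
      then show ?thesis using a by (simp add: mult_ac)
    qed
  qed
  have "(\<Sum>k=2..<n. (x 1 / x k) powr q * J k) \<le> (\<Sum>k=2..<n. 2 powr \<bar>q\<bar> * (x 1 / x n) powr q * J k
      + c * x n powr (- \<beta> - 1) * (step x k * (x 1 / x k) powr p))"
    by (intro sum_mono k) auto
  also have "\<dots> = 2 powr \<bar>q\<bar> * (x 1 / x n) powr q * (\<Sum>k=2..<n. J k)
      + c * x n powr (- \<beta> - 1) * (\<Sum>k=2..<n. step x k * (x 1 / x k) powr p)"
    by (simp add: sum.distrib sum_distrib_left)
  also have "\<dots> \<le> 2 powr \<bar>q\<bar> * (x 1 / x n) powr q * ((2 * \<kappa>) powr \<beta> * (x 1 powr (- \<beta>) * (x 1 / x n) powr (\<beta> - \<beta> / r)))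
      + c * x n powr (- \<beta> - 1) * (\<kappa> powr \<bar>p\<bar> / \<bar>1 - p\<bar> * (x 1 * (x 1 / x n) powr (min 1 p - 1)))"
    using beta p assms unfolding J_def
    by (intro add_mono mult_left_mono kernel_sum_le sum_step_powr_le) (auto simp: c_def)
  also have "\<dots> = 2 powr \<bar>q\<bar> * (2 * \<kappa>) powr \<beta> * (x 1 powr (- \<beta>) * ((x 1 / x n) powr q * (x 1 / x n) powr (\<beta> - \<beta> / r)))
      + c * (\<kappa> powr \<bar>p\<bar> / \<bar>1 - p\<bar>) * (x n powr (- \<beta> - 1) * (x 1 * (x 1 / x n) powr (min 1 p - 1)))"
    by (simp only: mult_ac)
  also have "(x 1 / x n) powr q * (x 1 / x n) powr (\<beta> - \<beta> / r) = (x 1 / x n) powr e"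
    by (simp add: powr_add[symmetric] qe)
  also have "x n powr (- \<beta> - 1) * (x 1 * (x 1 / x n) powr (min 1 p - 1)) = x 1 powr (- \<beta>) * (x 1 / x n) powr (min (1 + \<beta>) e)"
  proof -
    have "x n powr (- \<beta> - 1) * x 1 = x 1 powr (- \<beta>) * (x 1 / x n) powr (\<beta> + 1)"
      using pos by (simp add: powr_divide powr_minus powr_diff powr_add field_simps)
    then have "x n powr (- \<beta> - 1) * (x 1 * (x 1 / x n) powr (min 1 p - 1)) =
        x 1 powr (- \<beta>) * ((x 1 / x n) powr (\<beta> + 1) * (x 1 / x n) powr (min 1 p - 1))"
      by (simp only: mult.assoc[symmetric])
    also have "(x 1 / x n) powr (\<beta> + 1) * (x 1 / x n) powr (min 1 p - 1) = (x 1 / x n) powr (min (1 + \<beta>) e)"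
      by (simp add: powr_add[symmetric] p(3)[symmetric])
    finally show ?thesis .
  qed
  also have "2 powr \<bar>q\<bar> * (2 * \<kappa>) powr \<beta> * (x 1 powr (- \<beta>) * (x 1 / x n) powr e)
    \<le> 2 powr \<bar>q\<bar> * (2 * \<kappa>) powr \<beta> * (x 1 powr (- \<beta>) * (x 1 / x n) powr (min (1 + \<beta>) e))"
    using assms by (intro mult_left_mono ratio_powr_mono) auto
  finally have "(\<Sum>k=2..<n. (x 1 / x k) powr q * J k)
    \<le> (2 powr \<bar>q\<bar> * (2 * \<kappa>) powr \<beta> + c * (\<kappa> powr \<bar>p\<bar> / \<bar>1 - p\<bar>)) * (x 1 powr (- \<beta>) * (x 1 / x n) powr (min (1 + \<beta>) e))"
    by (simp add: distrib_right)
  then show ?thesis by (simp add: interior_const_def c_def p_def q_def e_def J_def)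
qed

text \<open>The distance \<open>z n - x 1\<close> is comparable with \<open>x n\<close> even for
  \<open>n = 2\<close>, since the second step is at least \<open>x 1 / \<kappa>\<close>. The mean
  value theorem for the kernel then gives the factor
  \<open>x 1 * x n powr (- \<beta> - 1)\<close>.\<close>

lemma kernel_first_le:
  assumes "2 \<le> n" "n \<le> N"
  shows "(z n - x 1) powr (- \<beta>) - (z n) powr (- \<beta>)
    \<le> \<beta> * (2 * (\<kappa> + 1)) powr (\<beta> + 1) * (x 1 powr (- \<beta>) * (x 1 / x n) powr (1 + \<beta>))"
proof -
  have pos: "0 < x 1" "0 < x n" "0 < \<kappa>" using x_pos[of 1] x_pos[of n] assms kappa by auto
  have "x 1 = x 1 powr (1 / r) * x 1 powr (1 - 1 / r)" using pos by (simp add: powr_add[symmetric])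
  also have "\<dots> \<le> x 1 powr (1 / r) * x 2 powr (1 - 1 / r)" using assms by (intro grading_mono) auto
  also have "\<dots> \<le> \<kappa> * step x 2" using assms by (intro step_lower) auto
  also have "\<dots> \<le> \<kappa> * (x n - x 1)"
    using assms kappa x_le[of 2 n] by (intro mult_left_mono) (auto simp: step_def)
  finally have "x n \<le> (\<kappa> + 1) * (x n - x 1)" by (simp add: algebra_simps)
  moreover have "(x n - x 1) / 2 \<le> z n - x 1"
  proof -
    have "x 1 \<le> x (n - 1)" using assms by (intro x_le) auto
    moreover have "x (n - 1) + step x n / 2 \<le> z n" using assms by (intro z_bounds) auto
    ultimately show ?thesis by (simp add: step_def field_simps)
  qed
  then have "(\<kappa> + 1) * (x n - x 1) \<le> (\<kappa> + 1) * (2 * (z n - x 1))" using pos by (intro mult_left_mono) auto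
  ultimately have "x n \<le> (2 * (\<kappa> + 1)) * (z n - x 1)" by (simp add: algebra_simps)
  then have zx: "x n / (2 * (\<kappa> + 1)) \<le> z n - x 1" using pos by (simp add: divide_le_eq mult.commute)
  have "(z n - x 1) powr (- \<beta>) - (z n) powr (- \<beta>) \<le> \<beta> * (z n - (z n - x 1)) * (z n - x 1) powr (- \<beta> - 1)"
    using x_less_z[of 1 n] pos beta assms by (intro neg_power_diff_le) auto
  also have "\<dots> = \<beta> * x 1 * (z n - x 1) powr (- \<beta> - 1)" by simp
  also have "\<dots> \<le> \<beta> * x 1 * (x n / (2 * (\<kappa> + 1))) powr (- \<beta> - 1)"
    using zx pos beta by (intro mult_left_mono powr_mono2') auto
  also have "\<dots> = \<beta> * (2 * (\<kappa> + 1)) powr (\<beta> + 1) * (x 1 powr (- \<beta>) * (x 1 / x n) powr (1 + \<beta>))"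
  proof -
    have 1: "(x n / (2 * (\<kappa> + 1))) powr (- \<beta> - 1) = x n powr (- \<beta> - 1) * (2 * (\<kappa> + 1)) powr (\<beta> + 1)"
    proof -
      have "- \<beta> - 1 = - (\<beta> + 1)" by simp
      then show ?thesis using pos by (simp only: powr_divide powr_minus) (simp add: field_simps)
    qed
    have 2: "x 1 * x n powr (- \<beta> - 1) = x 1 powr (- \<beta>) * (x 1 / x n) powr (1 + \<beta>)"
      using pos by (simp add: powr_divide powr_minus powr_diff powr_add field_simps)
    show ?thesis unfolding 1 2[symmetric] by (simp only: mult_ac)
  qed
  finally show ?thesis .
qed

end

section \<open>The consistency error\<close>

text \<open>The first summand serves \<open>n = 1\<close>; the other three serve
  \<open>n \<ge> 2\<close> and belong to the first interval, the intermediate ones and the last. The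
  divisor is the normalisation of the Caputo derivative.\<close>

definition consistency_const :: "real \<Rightarrow> real \<Rightarrow> real \<Rightarrow> real \<Rightarrow> real \<Rightarrow> real" where
  "consistency_const r \<kappa> \<beta> \<mu> A =
     ((14 * A * tangent_const \<mu> 2 + 4 * A) / (1 - \<beta>) * 4 powr \<beta>
      + (2 + \<kappa>\<^sup>2) * A * tangent_const \<mu> \<kappa> * (\<beta> * (2 * (\<kappa> + 1)) powr (\<beta> + 1))
      + (2 + \<kappa>\<^sup>2) * A * \<kappa> powr (3 - \<mu>) * ((1 + \<kappa> ^ 3) * \<kappa>) ^ 3 * interior_const r \<kappa> \<beta> \<mu>
      + 3 * A * \<kappa> powr (3 - \<mu>) * (\<kappa> powr (3 - \<beta>) / (1 - \<beta>)))
     / Gamma (1 - \<beta>)"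

locale graded_mesh_function = graded_mesh r \<kappa> T \<beta> N x + weakly_singular v v1 v2 v3 T \<mu> A
  for r \<kappa> T \<beta> N x v v1 v2 v3 \<mu> A
begin

lemma consts_nonneg: "0 \<le> tangent_const \<mu> \<kappa>" "0 \<le> tangent_const \<mu> 2" "0 \<le> interior_const r \<kappa> \<beta> \<mu>"
  using mu kappa beta by (auto simp: tangent_const_def interior_const_def intro!: divide_nonneg_nonneg add_nonneg_nonneg)

lemma Gamma_pos: "0 < Gamma (1 - \<beta>)"
  using beta by (intro Gamma_real_pos) simp

lemma consistency_const_ge:
  "(14 * A * tangent_const \<mu> 2 + 4 * A) / (1 - \<beta>) * 4 powr \<beta> \<le> consistency_const r \<kappa> \<beta> \<mu> A * Gamma (1 - \<beta>)"
  "(2 + \<kappa>\<^sup>2) * A * tangent_const \<mu> \<kappa> * (\<beta> * (2 * (\<kappa> + 1)) powr (\<beta> + 1))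
   + (2 + \<kappa>\<^sup>2) * A * \<kappa> powr (3 - \<mu>) * ((1 + \<kappa> ^ 3) * \<kappa>) ^ 3 * interior_const r \<kappa> \<beta> \<mu>
   + 3 * A * \<kappa> powr (3 - \<mu>) * (\<kappa> powr (3 - \<beta>) / (1 - \<beta>)) \<le> consistency_const r \<kappa> \<beta> \<mu> A * Gamma (1 - \<beta>)"
  (is "?c1 + ?c2 + ?c3 \<le> _")
proof -
  let ?c0 = "(14 * A * tangent_const \<mu> 2 + 4 * A) / (1 - \<beta>) * 4 powr \<beta>"
  have eq: "consistency_const r \<kappa> \<beta> \<mu> A * Gamma (1 - \<beta>) = ?c0 + ?c1 + ?c2 + ?c3"
    unfolding consistency_const_def using Gamma_pos by (intro nonzero_eq_divide_eq[THEN iffD1]) auto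
  have "0 \<le> ?c0" "0 \<le> ?c1" "0 \<le> ?c2" "0 \<le> ?c3"
    using A_nonneg consts_nonneg kappa beta by (simp_all add: mult_nonneg_nonneg)
  then show "?c0 \<le> consistency_const r \<kappa> \<beta> \<mu> A * Gamma (1 - \<beta>)"
    "?c1 + ?c2 + ?c3 \<le> consistency_const r \<kappa> \<beta> \<mu> A * Gamma (1 - \<beta>)"
    unfolding eq by linarith+
qed

lemma quad_error_first_mesh:
  assumes "2 \<le> N" "s \<in> {x 0..x 1}"
  shows "\<bar>v s - quad_interp v (x 0) (x 1) (x 2) s\<bar> \<le> (2 + \<kappa>\<^sup>2) * (A * tangent_const \<mu> \<kappa> * x 1 powr \<mu>)"
proof -
  have "x 1 \<le> \<kappa>\<^sup>2 * (x 2 - x 1)"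
    using step_le_next[of 1] assms by (simp add: step_def x0 numeral_2_eq_2)
  moreover have "x 2 \<le> \<kappa> * x 1" using ratio[of 1] assms by (simp add: numeral_2_eq_2)
  ultimately show ?thesis
    using quad_error_first[of "x 1" "x 2" "\<kappa>\<^sup>2" \<kappa> s] x_pos[of 1] x_less[of 1 2] x_le_T[of 2] assms
    by (simp add: x0)
qed

text \<open>The neighbour ratio moves the bound on \<open>v3\<close> from \<open>x (k - 1)\<close>
  to \<open>x k\<close>, and the stencil is at most \<open>1 + \<kappa> ^ 3\<close> steps wide. By
  the grading, the cube of the step times \<open>x k powr (\<mu> - 3)\<close> becomes the stated
  weight.\<close>

lemma quad_error_mesh:
  assumes "2 \<le> k" "Suc k \<le> N" "s \<in> {x (k - 1)..x k}"
  shows "\<bar>v s - quad_interp v (x (k - 1)) (x k) (x (k + 1)) s\<bar>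
    \<le> (2 + \<kappa>\<^sup>2) * A * \<kappa> powr (3 - \<mu>) * ((1 + \<kappa> ^ 3) * \<kappa>) ^ 3 * (x 1 powr \<mu> * (x 1 / x k) powr (3 / r - \<mu>))"
proof -
  have pos: "0 < x 1" "0 < x (k - 1)" "x (k - 1) < x k" "x k < x (k + 1)" "x (k + 1) \<le> T"
    using x_pos[of 1] x_pos[of "k - 1"] x_less[of "k - 1" k] x_less[of k "k + 1"] x_le_T[of "k + 1"] assms
    by auto
  have K: "0 < \<kappa>" using kappa by simp
  have h: "x k - x (k - 1) \<le> \<kappa>\<^sup>2 * (x (k + 1) - x k)"
    using step_le_next[of k] assms by (simp add: step_def)
  have "\<bar>v s - quad_interp v (x (k - 1)) (x k) (x (k + 1)) s\<bar>
    \<le> (2 + \<kappa>\<^sup>2) * (A * x (k - 1) powr (\<mu> - 3) * (x (k + 1) - x (k - 1)) ^ 3)"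
    by (rule quad_error[OF pos(2,3,4,5) h assms(3)])
  also have "\<dots> \<le> (2 + \<kappa>\<^sup>2) * (A * (\<kappa> powr (3 - \<mu>) * x k powr (\<mu> - 3)) *
      ((1 + \<kappa> ^ 3) * \<kappa> * (x 1 powr (1 / r) * x k powr (1 - 1 / r))) ^ 3)"
  proof (intro mult_left_mono mult_mono power_mono)
    have "x k \<le> \<kappa> * x (k - 1)" using ratio[of "k - 1"] assms by simp
    then have "x (k - 1) powr (\<mu> - 3) \<le> \<kappa> powr \<bar>\<mu> - 3\<bar> * x k powr (\<mu> - 3)"
      using pos kappa by (intro powr_le_of_ratio) auto
    then show "x (k - 1) powr (\<mu> - 3) \<le> \<kappa> powr (3 - \<mu>) * x k powr (\<mu> - 3)" using mu by simp
    have "x (k + 1) - x (k - 1) = step x k + step x (Suc k)" by (simp add: step_def)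
    also have "\<dots> \<le> (1 + \<kappa> ^ 3) * step x k" using next_step_le[of k] assms by (simp add: algebra_simps)
    also have "\<dots> \<le> (1 + \<kappa> ^ 3) * (\<kappa> * (x 1 powr (1 / r) * x k powr (1 - 1 / r)))"
      using assms K by (intro mult_left_mono step_upper) auto
    finally show "x (k + 1) - x (k - 1) \<le> (1 + \<kappa> ^ 3) * \<kappa> * (x 1 powr (1 / r) * x k powr (1 - 1 / r))"
      by (simp add: mult.assoc)
  qed (use pos A_nonneg K in auto)
  also have "\<dots> = (2 + \<kappa>\<^sup>2) * A * \<kappa> powr (3 - \<mu>) * ((1 + \<kappa> ^ 3) * \<kappa>) ^ 3 *
      (x k powr (\<mu> - 3) * (x 1 powr (1 / r) * x k powr (1 - 1 / r)) ^ 3)"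
    by (simp only: power_mult_distrib mult_ac)
  also have "x k powr (\<mu> - 3) * (x 1 powr (1 / r) * x k powr (1 - 1 / r)) ^ 3 = x 1 powr \<mu> * (x 1 / x k) powr (3 / r - \<mu>)"
  proof -
    have xk: "0 < x k" using pos by simp
    have "(x 1 powr (1 / r) * x k powr (1 - 1 / r)) ^ 3 = x 1 powr (3 / r) * x k powr (3 - 3 / r)"
      using pos(1) xk by (simp add: power_mult_distrib powr_power algebra_simps)
    then have "x k powr (\<mu> - 3) * (x 1 powr (1 / r) * x k powr (1 - 1 / r)) ^ 3 =
        x 1 powr (3 / r) * (x k powr (\<mu> - 3) * x k powr (3 - 3 / r))" by simp
    also have "\<dots> = x 1 powr (3 / r) * x k powr (\<mu> - 3 / r)" by (simp add: powr_add[symmetric])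
    also have "\<dots> = x 1 powr \<mu> * (x 1 / x k) powr (3 / r - \<mu>)"
      using pos(1) xk by (simp add: powr_divide powr_diff field_simps)
    finally show ?thesis .
  qed
  finally show ?thesis .
qed

text \<open>The squared step from the remainder and the power \<open>1 - \<beta>\<close> from the
  kernel combine to \<open>step x n powr (3 - \<beta>)\<close>, the origin of
  \<open>(3 - \<beta>) / r\<close> in the rate.\<close>

lemma lin_bound_mesh:
  assumes "2 \<le> n" "n \<le> N"
  shows "3 * A * x (n - 1) powr (\<mu> - 3) * (step x n)\<^sup>2 * (step x n powr (1 - \<beta>) / (1 - \<beta>))
    \<le> 3 * A * \<kappa> powr (3 - \<mu>) * (\<kappa> powr (3 - \<beta>) / (1 - \<beta>)) *
       (x 1 powr (\<mu> - \<beta>) * (x 1 / x n) powr ((3 - \<beta>) / r - \<mu> + \<beta>))"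
proof -
  have pos: "0 < x 1" "0 < x (n - 1)" "x (n - 1) < x n" "0 < x n" "0 < step x n"
    using assms by (auto intro!: x_pos x_less step_pos)
  have K: "0 < \<kappa>" using kappa by simp
  let ?g = "x 1 powr (1 / r) * x n powr (1 - 1 / r)"
  have "3 * A * x (n - 1) powr (\<mu> - 3) * (step x n)\<^sup>2 * (step x n powr (1 - \<beta>) / (1 - \<beta>))
    = 3 * A * x (n - 1) powr (\<mu> - 3) * (step x n powr (3 - \<beta>) / (1 - \<beta>))"
  proof -
    have "(step x n)\<^sup>2 * step x n powr (1 - \<beta>) = step x n powr 2 * step x n powr (1 - \<beta>)"
      using pos by simp
    also have "\<dots> = step x n powr (3 - \<beta>)" by (simp add: powr_add[symmetric])
    finally show ?thesis by (simp add: mult.assoc)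
  qed
  also have "\<dots> \<le> 3 * A * (\<kappa> powr (3 - \<mu>) * x n powr (\<mu> - 3)) * ((\<kappa> powr (3 - \<beta>) * ?g powr (3 - \<beta>)) / (1 - \<beta>))"
  proof (intro mult_mono mult_left_mono divide_right_mono)
    have "x n \<le> \<kappa> * x (n - 1)" using ratio[of "n - 1"] assms by simp
    then have "x (n - 1) powr (\<mu> - 3) \<le> \<kappa> powr \<bar>\<mu> - 3\<bar> * x n powr (\<mu> - 3)"
      using pos kappa by (intro powr_le_of_ratio) auto
    then show "x (n - 1) powr (\<mu> - 3) \<le> \<kappa> powr (3 - \<mu>) * x n powr (\<mu> - 3)" using mu by simp
    have "step x n powr (3 - \<beta>) \<le> (\<kappa> * ?g) powr (3 - \<beta>)"
      using assms pos beta by (intro powr_mono2 step_upper) auto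
    also have "\<dots> = \<kappa> powr (3 - \<beta>) * ?g powr (3 - \<beta>)" by (rule powr_mult)
    finally show "step x n powr (3 - \<beta>) \<le> \<kappa> powr (3 - \<beta>) * ?g powr (3 - \<beta>)" .
  qed (use A_nonneg beta in auto)
  also have "\<dots> = 3 * A * \<kappa> powr (3 - \<mu>) * (\<kappa> powr (3 - \<beta>) / (1 - \<beta>)) * (x n powr (\<mu> - 3) * ?g powr (3 - \<beta>))"
    by simp
  also have "x n powr (\<mu> - 3) * ?g powr (3 - \<beta>) = x 1 powr (\<mu> - \<beta>) * (x 1 / x n) powr ((3 - \<beta>) / r - \<mu> + \<beta>)"
  proof -
    define e where "e = (3 - \<beta>) / r"
    have "?g powr (3 - \<beta>) = x 1 powr e * x n powr (3 - \<beta> - e)"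
    proof -
      have "1 / r * (3 - \<beta>) = e" "(1 - 1 / r) * (3 - \<beta>) = 3 - \<beta> - e"
        by (simp_all add: e_def left_diff_distrib)
      then show ?thesis by (simp only: powr_mult powr_powr)
    qed
    then have "x n powr (\<mu> - 3) * ?g powr (3 - \<beta>) = x 1 powr e * (x n powr (\<mu> - 3) * x n powr (3 - \<beta> - e))"
      by simp
    also have "\<dots> = x 1 powr e * x n powr (\<mu> - \<beta> - e)"
    proof -
      have "(\<mu> - 3) + (3 - \<beta> - e) = \<mu> - \<beta> - e" by simp
      then show ?thesis by (simp only: powr_add[symmetric])
    qed
    also have "\<dots> = x 1 powr (\<mu> - \<beta>) * (x 1 / x n) powr (e - \<mu> + \<beta>)"
      using pos by (simp add: powr_divide powr_diff powr_add field_simps)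
    finally show ?thesis by (simp add: e_def)
  qed
  finally show ?thesis .
qed

lemma integral_split:
  fixes f :: "real \<Rightarrow> real"
  assumes "\<And>k. 1 \<le> k \<Longrightarrow> k \<le> m \<Longrightarrow> f integrable_on {x (k - 1)..x k}" "m \<le> N"
  shows "f integrable_on {0..x m} \<and> integral {0..x m} f = (\<Sum>k=1..<Suc m. integral {x (k - 1)..x k} f)"
  using assms
proof (induction m)
  case (Suc m)
  then have IH: "f integrable_on {0..x m}" "integral {0..x m} f = (\<Sum>k=1..<Suc m. integral {x (k - 1)..x k} f)"
    by auto
  have le: "0 \<le> x m" "x m \<le> x (Suc m)" using x_le[of 0 m] x_le[of m "Suc m"] x0 Suc.prems by auto
  have i: "f integrable_on {x m..x (Suc m)}" using Suc.prems(1)[of "Suc m"] by simp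
  have "f integrable_on {0..x (Suc m)}"
    by (rule Henstock_Kurzweil_Integration.integrable_combine[OF le IH(1) i])
  moreover from this have "integral {0..x (Suc m)} f = integral {0..x m} f + integral {x m..x (Suc m)} f"
    by (rule Henstock_Kurzweil_Integration.integral_combine[OF le, symmetric])
  ultimately show ?case by (simp add: IH(2) sum.atLeastLessThan_Suc del: sum.op_ivl_Suc)
next
  case 0
  then show ?case using has_integral_refl(2)[of f 0] by (auto simp: x0)
qed

lemma tstar_eq: "tstar (1 - \<beta> / 2) x n = z n"
  by (simp add: tstar_def z_def)

text \<open>All three contributions are brought to the common size \<open>R\<close>; this is
  possible because \<open>x 1 / x n \<le> 1\<close>, so that lowering an exponent to the minimum
  only enlarges the bound.\<close>

lemma error_later:
  assumes n: "2 \<le> n" "n \<le> N"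
  shows "\<bar>caputo \<beta> v (tstar (1 - \<beta> / 2) x n) - alikhanov \<beta> (1 - \<beta> / 2) x v n\<bar>
    \<le> consistency_const r \<kappa> \<beta> \<mu> A * x 1 powr (\<mu> - \<beta>) *
      (x 1 / x n) powr (min (1 + \<beta>) ((3 - \<beta>) / r - \<mu> + \<beta>))"
proof -
  define K where "K = (\<lambda>s. (z n - s) powr (- \<beta>))"
  define f where "f = (\<lambda>s. K s * deriv v s)"
  define P where "P k = integral {x (k - 1)..x k} (\<lambda>s. K s * deriv (quad_interp v (x (k - 1)) (x k) (x (k + 1))) s)" for k
  define L where "L = integral {x (n - 1)..z n} (\<lambda>s. K s * deriv (lin_interp v (x (n - 1)) (x n)) s)"
  define J where "J k = K (x k) - K (x (k - 1))" for k
  define \<gamma> where "\<gamma> = min (1 + \<beta>) ((3 - \<beta>) / r - \<mu> + \<beta>)"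
  define R where "R = x 1 powr (\<mu> - \<beta>) * (x 1 / x n) powr \<gamma>"
  define G where "G k = (if k = 1 then (2 + \<kappa>\<^sup>2) * (A * tangent_const \<mu> \<kappa> * x 1 powr \<mu>)
    else (2 + \<kappa>\<^sup>2) * A * \<kappa> powr (3 - \<mu>) * ((1 + \<kappa> ^ 3) * \<kappa>) ^ 3 * (x 1 powr \<mu> * (x 1 / x k) powr (3 / r - \<mu>)))" for k
  have pos: "0 < x 1" "0 < x n" "0 < \<kappa>" "0 \<le> R" using x_pos[of 1] x_pos[of n] n kappa by (auto simp: R_def)
  have piece: "f integrable_on {x (k - 1)..x k} \<and> \<bar>integral {x (k - 1)..x k} f - P k\<bar> \<le> G k * J k"
    if k: "1 \<le> k" "k < n" for k
  proof -
    have B: "\<bar>v s - quad_interp v (x (k - 1)) (x k) (x (k + 1)) s\<bar> \<le> G k" if s: "s \<in> {x (k - 1)..x k}" for s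
    proof (cases "k = 1")
      case True
      then show ?thesis using quad_error_first_mesh[of s] s n by (simp add: G_def numeral_2_eq_2)
    next
      case False
      then show ?thesis using quad_error_mesh[of k s] s n k by (simp add: G_def)
    qed
    have "0 \<le> x (k - 1)" "x (k - 1) < x k" "x k < x (k + 1)" "x (k + 1) \<le> T" "x k < z n"
      using k n x_le[of 0 "k - 1"] x0 x_less[of "k - 1" k] x_less[of k "k + 1"] x_le_T[of "k + 1"] x_less_z[of k n]
      by auto
    note q = quad_piece[OF this beta(1) B]
    show ?thesis using q unfolding f_def K_def P_def J_def by blast
  qed
  have zn: "z n = x n - \<beta> / 2 * (x n - x (n - 1))" by (simp add: z_def step_def)
  have xn1: "0 < x (n - 1)" "x (n - 1) < x n" "x n \<le> T" "x (n - 1) \<le> z n"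
    using n x_pos[of "n - 1"] x_less[of "n - 1" n] x_le_T[of n] x_less_z[of "n - 1" n] by auto
  note last = lin_piece[OF xn1(1-3) beta zn]
  have fl: "f integrable_on {x (n - 1)..z n}" using last(1) by (simp add: f_def K_def)
  have "\<bar>integral {x (n - 1)..z n} f - L\<bar>
      \<le> 3 * A * x (n - 1) powr (\<mu> - 3) * (step x n)\<^sup>2 * (step x n powr (1 - \<beta>) / (1 - \<beta>))"
    using last(2) by (simp add: f_def K_def L_def step_def)
  also have "\<dots> \<le> 3 * A * \<kappa> powr (3 - \<mu>) * (\<kappa> powr (3 - \<beta>) / (1 - \<beta>)) *
       (x 1 powr (\<mu> - \<beta>) * (x 1 / x n) powr ((3 - \<beta>) / r - \<mu> + \<beta>))"
    by (rule lin_bound_mesh[OF n])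
  also have "\<dots> \<le> 3 * A * \<kappa> powr (3 - \<mu>) * (\<kappa> powr (3 - \<beta>) / (1 - \<beta>)) * R"
    unfolding R_def \<gamma>_def using A_nonneg beta n by (intro mult_left_mono ratio_powr_mono) auto
  finally have EL: "\<bar>integral {x (n - 1)..z n} f - L\<bar> \<le> 3 * A * \<kappa> powr (3 - \<mu>) * (\<kappa> powr (3 - \<beta>) / (1 - \<beta>)) * R" .
  have xb: "x 1 powr \<mu> * (x 1 powr (- \<beta>) * y) = x 1 powr (\<mu> - \<beta>) * y" for y
    using pos by (simp add: powr_diff powr_minus field_simps)
  have "G 1 * J 1 \<le> (2 + \<kappa>\<^sup>2) * (A * tangent_const \<mu> \<kappa> * x 1 powr \<mu>) *
      (\<beta> * (2 * (\<kappa> + 1)) powr (\<beta> + 1) * (x 1 powr (- \<beta>) * (x 1 / x n) powr (1 + \<beta>)))"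
    using kernel_first_le[OF n] A_nonneg consts_nonneg
    by (auto simp: G_def J_def K_def x0 intro!: mult_left_mono)
  also have "\<dots> = (2 + \<kappa>\<^sup>2) * A * tangent_const \<mu> \<kappa> * (\<beta> * (2 * (\<kappa> + 1)) powr (\<beta> + 1)) *
      (x 1 powr (\<mu> - \<beta>) * (x 1 / x n) powr (1 + \<beta>))"
    unfolding xb[symmetric] by (simp only: mult_ac)
  also have "\<dots> \<le> (2 + \<kappa>\<^sup>2) * A * tangent_const \<mu> \<kappa> * (\<beta> * (2 * (\<kappa> + 1)) powr (\<beta> + 1)) * R"
    unfolding R_def \<gamma>_def using A_nonneg consts_nonneg beta n
    by (intro mult_left_mono ratio_powr_mono) auto
  finally have E1: "G 1 * J 1 \<le> (2 + \<kappa>\<^sup>2) * A * tangent_const \<mu> \<kappa> * (\<beta> * (2 * (\<kappa> + 1)) powr (\<beta> + 1)) * R" .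
  define c where "c = (2 + \<kappa>\<^sup>2) * A * \<kappa> powr (3 - \<mu>) * ((1 + \<kappa> ^ 3) * \<kappa>) ^ 3"
  have c: "0 \<le> c" using A_nonneg pos by (simp add: c_def)
  have "(\<Sum>k=2..<n. G k * J k) = (\<Sum>k=2..<n. c * x 1 powr \<mu> * ((x 1 / x k) powr (3 / r - \<mu>) * J k))"
    by (intro sum.cong) (auto simp: G_def c_def)
  also have "\<dots> = c * x 1 powr \<mu> * (\<Sum>k=2..<n. (x 1 / x k) powr (3 / r - \<mu>) * J k)"
    by (simp add: sum_distrib_left)
  also have "\<dots> \<le> c * x 1 powr \<mu> * (interior_const r \<kappa> \<beta> \<mu> * (x 1 powr (- \<beta>) * (x 1 / x n) powr \<gamma>))"
    using interior_sum_le[OF n, of \<mu>] c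
    by (intro mult_left_mono) (auto simp: J_def K_def \<gamma>_def)
  also have "\<dots> = c * interior_const r \<kappa> \<beta> \<mu> * R"
    unfolding R_def xb[symmetric] by (simp only: mult_ac)
  finally have E2: "(\<Sum>k=2..<n. G k * J k) \<le> c * interior_const r \<kappa> \<beta> \<mu> * R" .
  have split: "f integrable_on {0..x (n - 1)}" "integral {0..x (n - 1)} f = (\<Sum>k=1..<n. integral {x (k - 1)..x k} f)"
    using integral_split[of "n - 1" f] piece n by (auto simp del: sum.op_ivl_Suc)
  have "f integrable_on {0..z n}"
    by (rule Henstock_Kurzweil_Integration.integrable_combine[OF _ xn1(4) split(1) fl]) (use xn1 in simp)
  then have "integral {0..z n} f = (\<Sum>k=1..<n. integral {x (k - 1)..x k} f) + integral {x (n - 1)..z n} f"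
    using Henstock_Kurzweil_Integration.integral_combine[of 0 "x (n - 1)" "z n" f] xn1 split(2) by simp
  then have "integral {0..z n} f - ((\<Sum>k=1..<n. P k) + L)
      = (\<Sum>k=1..<n. integral {x (k - 1)..x k} f - P k) + (integral {x (n - 1)..z n} f - L)"
    by (simp add: sum_subtractf)
  then have "\<bar>integral {0..z n} f - ((\<Sum>k=1..<n. P k) + L)\<bar>
      \<le> \<bar>\<Sum>k=1..<n. integral {x (k - 1)..x k} f - P k\<bar> + \<bar>integral {x (n - 1)..z n} f - L\<bar>"
    by (simp only: abs_triangle_ineq)
  moreover have "\<bar>\<Sum>k=1..<n. integral {x (k - 1)..x k} f - P k\<bar> \<le> (\<Sum>k=1..<n. G k * J k)"
    using piece by (intro order_trans[OF sum_abs] sum_mono) auto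
  moreover have "(\<Sum>k=1..<n. G k * J k) = G 1 * J 1 + (\<Sum>k=2..<n. G k * J k)"
    using n by (simp add: sum.atLeast_Suc_lessThan numeral_2_eq_2)
  ultimately have "\<bar>integral {0..z n} f - ((\<Sum>k=1..<n. P k) + L)\<bar> \<le>
      (2 + \<kappa>\<^sup>2) * A * tangent_const \<mu> \<kappa> * (\<beta> * (2 * (\<kappa> + 1)) powr (\<beta> + 1)) * R + c * interior_const r \<kappa> \<beta> \<mu> * R
      + 3 * A * \<kappa> powr (3 - \<mu>) * (\<kappa> powr (3 - \<beta>) / (1 - \<beta>)) * R"
    using E1 E2 EL by linarith
  also have "\<dots> \<le> (consistency_const r \<kappa> \<beta> \<mu> A * Gamma (1 - \<beta>)) * R"
    unfolding distrib_right[of _ _ R, symmetric] c_def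
    by (rule mult_right_mono[OF consistency_const_ge(2) pos(4)])
  finally have "\<bar>integral {0..z n} f - ((\<Sum>k=1..<n. P k) + L)\<bar> / Gamma (1 - \<beta>) \<le> consistency_const r \<kappa> \<beta> \<mu> A * R"
    using Gamma_pos beta by (simp add: divide_le_eq mult_ac)
  moreover have "caputo \<beta> v (tstar (1 - \<beta> / 2) x n) - alikhanov \<beta> (1 - \<beta> / 2) x v n
      = (integral {0..z n} f - ((\<Sum>k=1..<n. P k) + L)) / Gamma (1 - \<beta>)"
    unfolding caputo_def alikhanov_def tstar_eq f_def K_def P_def L_def
    by (simp add: diff_divide_distrib)
  moreover have "\<bar>Gamma (1 - \<beta>)\<bar> = Gamma (1 - \<beta>)" using Gamma_pos beta by simp
  ultimately show ?thesis by (simp add: R_def \<gamma>_def mult.assoc)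
qed

text \<open>For \<open>n = 1\<close> the sum in \<open>alikhanov\<close> is empty and the linear
  piece on \<open>{0..z 1}\<close> is everything; the ratio \<open>x 1 / x n\<close> is 1, so no
  second power appears.\<close>

lemma error_first:
  assumes "1 \<le> N"
  shows "\<bar>caputo \<beta> v (tstar (1 - \<beta> / 2) x 1) - alikhanov \<beta> (1 - \<beta> / 2) x v 1\<bar>
    \<le> consistency_const r \<kappa> \<beta> \<mu> A * x 1 powr (\<mu> - \<beta>)"
proof -
  let ?D = "integral {0..z 1} (\<lambda>s. (z 1 - s) powr (- \<beta>) * deriv v s)
        - integral {0..z 1} (\<lambda>s. (z 1 - s) powr (- \<beta>) * deriv (lin_interp v 0 (x 1)) s)"
  define c where "c = (14 * A * tangent_const \<mu> 2 + 4 * A) / (1 - \<beta>)"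
  have c: "0 \<le> c" using A_nonneg consts_nonneg beta by (simp add: c_def)
  have pos: "0 < x 1" "0 < \<kappa>" using x_pos[of 1] assms kappa by auto
  have z1: "z 1 = x 1 - \<beta> / 2 * x 1" by (simp only: z_def step_one)
  \<comment> \<open>The lower bound replaces \<open>(z 1 / 2) powr (- \<beta>)\<close> by
    \<open>(x 1 / 4) powr (- \<beta>)\<close>, whence the factor
    \<open>4 powr \<beta>\<close>.\<close>
  have "z 1 < x 1" "x 1 / 2 \<le> z 1" using z_bounds[of 1] assms by (auto simp: step_def x0)
  have "\<bar>?D\<bar> \<le> c * z 1 powr \<mu> * (z 1 / 2) powr (- \<beta>)"
    unfolding c_def using lin_piece_first(2)[OF pos(1) x_le_T[OF assms] beta z1] .
  also have "\<dots> \<le> c * x 1 powr \<mu> * (x 1 / 4) powr (- \<beta>)"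
    using \<open>z 1 < x 1\<close> \<open>x 1 / 2 \<le> z 1\<close> pos c mu beta
    by (intro mult_mono mult_left_mono powr_mono2 powr_mono2') auto
  also have "\<dots> = c * 4 powr \<beta> * x 1 powr (\<mu> - \<beta>)"
    using pos by (simp add: powr_divide powr_minus powr_diff field_simps)
  also have "\<dots> \<le> (consistency_const r \<kappa> \<beta> \<mu> A * Gamma (1 - \<beta>)) * x 1 powr (\<mu> - \<beta>)"
    unfolding c_def by (rule mult_right_mono[OF consistency_const_ge(1)]) simp
  finally have "\<bar>?D\<bar> / Gamma (1 - \<beta>) \<le> consistency_const r \<kappa> \<beta> \<mu> A * x 1 powr (\<mu> - \<beta>)"
    using Gamma_pos beta by (simp add: divide_le_eq mult_ac)
  moreover have "caputo \<beta> v (tstar (1 - \<beta> / 2) x 1) - alikhanov \<beta> (1 - \<beta> / 2) x v 1 = ?D / Gamma (1 - \<beta>)"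
    unfolding caputo_def alikhanov_def tstar_eq by (simp add: diff_divide_distrib x0)
  moreover have "\<bar>Gamma (1 - \<beta>)\<bar> = Gamma (1 - \<beta>)" using Gamma_pos beta by simp
  ultimately show ?thesis by simp
qed

end

section \<open>From the hypotheses of the theorem to uniform constants\<close>

lemma DERIV_deriv_within:
  assumes "Ck_on k f {0<..T}" "l < k" "s \<in> {0<..<T}"
  shows "(deriv_within l f {0<..T} has_real_derivative deriv_within (Suc l) f {0<..T} s) (at s)"
proof -
  have "deriv_within l f {0<..T} differentiable (at s within {0<..T})"
    using assms by (auto simp: Ck_on_def differentiable_on_def)
  then have "(deriv_within l f {0<..T} has_vector_derivative deriv_within (Suc l) f {0<..T} s) (at s within {0<..T})"
    by (simp add: vector_derivative_works)
  then have "(deriv_within l f {0<..T} has_vector_derivative deriv_within (Suc l) f {0<..T} s) (at s within {0<..<T})"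
    by (rule has_vector_derivative_within_subset) auto
  then show ?thesis
    using assms(3) by (simp add: has_real_derivative_iff_has_vector_derivative at_within_open[of s "{0<..<T}"])
qed

text \<open>On \<open>s \<le> T\<close> one has
  \<open>1 = s powr p * s powr (- p) \<le> T powr p * s powr (- p)\<close>. The absolute value is
  taken because the sign of \<open>C\<close> is not given.\<close>

lemma absorb_constant:
  fixes C T p s :: real
  assumes "0 < s" "s \<le> T" "0 \<le> p" "y \<le> C * (1 + s powr (- p))" "T powr p \<le> M"
  shows "y \<le> \<bar>C\<bar> * (1 + M) * s powr (- p)"
proof -
  have "1 = s powr p * s powr (- p)" using assms by (simp add: powr_add[symmetric])
  also have "\<dots> \<le> M * s powr (- p)"
    using assms powr_mono2[of p s T] by (intro mult_right_mono) auto
  finally have "1 + s powr (- p) \<le> (1 + M) * s powr (- p)" by (simp add: algebra_simps)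
  then have "\<bar>C\<bar> * (1 + s powr (- p)) \<le> \<bar>C\<bar> * ((1 + M) * s powr (- p))" by (rule mult_left_mono) simp
  moreover have "C * (1 + s powr (- p)) \<le> \<bar>C\<bar> * (1 + s powr (- p))" by (intro mult_right_mono) auto
  ultimately show ?thesis using assms(4) by (simp add: mult.assoc)
qed

lemma quasi_graded_uniform:
  assumes "quasi_graded r t" "0 \<le> r" "\<And>N. 1 \<le> N \<Longrightarrow> mesh T N (t N)"
  obtains \<kappa> where "1 \<le> \<kappa>"
    and "\<And>N n. 1 \<le> n \<Longrightarrow> n \<le> N \<Longrightarrow>
      step (t N) n \<le> \<kappa> * (t N 1 powr (1 / r) * t N n powr (1 - 1 / r))"
    and "\<And>N n. 1 \<le> n \<Longrightarrow> n \<le> N \<Longrightarrow>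
      t N 1 powr (1 / r) * t N n powr (1 - 1 / r) \<le> \<kappa> * step (t N) n"
    and "\<And>N n. 1 \<le> n \<Longrightarrow> Suc n \<le> N \<Longrightarrow> t N (Suc n) \<le> \<kappa> * t N n"
proof -
  have step1: "step (t N) 1 = t N 1" if "1 \<le> N" for N
    using assms(3)[OF that] by (simp add: step_def mesh_def)
  have tpos: "0 < t N n" if "1 \<le> n" "n \<le> N" for N n
    using that
  proof (induction n rule: dec_induct)
    case base
    then show ?case using assms(3)[of N] by (auto simp: mesh_def)
  next
    case (step n)
    then have "t N n < t N (Suc n)" using assms(3)[of N] by (auto simp: mesh_def)
    then show ?case using step by auto
  qed
  obtain c1 C1 where c1: "0 < c1" "0 < C1" and
    B1: "\<forall>(N, n)\<in>{(N, n). 1 \<le> n \<and> n \<le> N}. c1 \<le> t N n / (step (t N) 1 * real n powr r)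
      \<and> t N n / (step (t N) 1 * real n powr r) \<le> C1"
    using assms(1) unfolding quasi_graded_def comparable_on_def case_prod_beta by blast
  obtain c2 C2 where c2: "0 < c2" "0 < C2" and
    B2: "\<forall>(N, n)\<in>{(N, n). 1 \<le> n \<and> n \<le> N}.
      c2 \<le> step (t N) n / (step (t N) 1 powr (1 / r) * t N n powr (1 - 1 / r))
      \<and> step (t N) n / (step (t N) 1 powr (1 / r) * t N n powr (1 - 1 / r)) \<le> C2"
    using assms(1) unfolding quasi_graded_def comparable_on_def case_prod_beta by blast
  \<comment> \<open>\<open>C2\<close> and \<open>1 / c2\<close> give the two step bounds;
    \<open>C1 * 2 powr r / c1\<close> gives the neighbour ratio, since
    \<open>Suc n \<le> 2 * n\<close> for \<open>n \<ge> 1\<close>.\<close>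
  define \<kappa> where "\<kappa> = Max {1, C2, 1 / c2, C1 * 2 powr r / c1}"
  have kappa: "1 \<le> \<kappa>" "C2 \<le> \<kappa>" "1 / c2 \<le> \<kappa>" "C1 * 2 powr r / c1 \<le> \<kappa>"
    by (auto simp: \<kappa>_def)
  show ?thesis
  proof (rule that[OF kappa(1)])
    fix N n :: nat assume n: "1 \<le> n" "n \<le> N"
    define g where "g = t N 1 powr (1 / r) * t N n powr (1 - 1 / r)"
    have g: "0 < g" using tpos[of 1 N] tpos[of n N] n by (simp add: g_def)
    have b: "c2 \<le> step (t N) n / g" "step (t N) n / g \<le> C2"
      using bspec[OF B2, of "(N, n)"] n step1[of N] by (auto simp: g_def)
    have "step (t N) n \<le> C2 * g" using b g by (simp add: divide_le_eq)
    also have "\<dots> \<le> \<kappa> * g" using kappa g by (intro mult_right_mono) auto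
    finally show "step (t N) n \<le> \<kappa> * (t N 1 powr (1 / r) * t N n powr (1 - 1 / r))" by (simp add: g_def)
    have *: "c2 * g \<le> step (t N) n" using b g by (simp add: le_divide_eq)
    then have "0 \<le> step (t N) n" using c2 g by (meson less_imp_le mult_pos_pos order_trans)
    have "g \<le> 1 / c2 * step (t N) n" using * c2 by (simp add: field_simps)
    also have "\<dots> \<le> \<kappa> * step (t N) n" using kappa \<open>0 \<le> step (t N) n\<close> by (intro mult_right_mono) auto
    finally show "t N 1 powr (1 / r) * t N n powr (1 - 1 / r) \<le> \<kappa> * step (t N) n" by (simp add: g_def)
  next
    fix N n :: nat assume n: "1 \<le> n" "Suc n \<le> N"
    define \<tau> where "\<tau> = t N 1"
    have tau: "0 < \<tau>" using tpos[of 1 N] n by (simp add: \<tau>_def)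
    have np: "0 < real n powr r" "0 < real (Suc n) powr r" using n by auto
    have "t N (Suc n) / (\<tau> * real (Suc n) powr r) \<le> C1"
      using bspec[OF B1, of "(N, Suc n)"] n step1[of N] by (simp add: \<tau>_def)
    then have "t N (Suc n) \<le> C1 * (\<tau> * real (Suc n) powr r)" using tau np by (simp add: divide_le_eq)
    also have "\<dots> \<le> C1 * (\<tau> * (2 * real n) powr r)"
      using c1 tau assms(2) n by (intro mult_left_mono powr_mono2) auto
    also have "\<dots> = C1 * 2 powr r * (\<tau> * real n powr r)" by (simp add: powr_mult)
    also have "\<dots> \<le> C1 * 2 powr r * (t N n / c1)"
    proof -
      have "c1 \<le> t N n / (\<tau> * real n powr r)"
        using bspec[OF B1, of "(N, n)"] n step1[of N] by (simp add: \<tau>_def)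
      then have "c1 * (\<tau> * real n powr r) \<le> t N n" using tau np by (simp add: le_divide_eq)
      then show ?thesis using c1 by (intro mult_left_mono) (auto simp: field_simps)
    qed
    also have "\<dots> = C1 * 2 powr r / c1 * t N n" by simp
    also have "\<dots> \<le> \<kappa> * t N n"
      using kappa tpos[of n N] n by (intro mult_right_mono) auto
    finally show "t N (Suc n) \<le> \<kappa> * t N n" .
  qed
qed

theorem lemma3p1:
  fixes \<beta> \<sigma> r T \<mu> C :: real
    and t :: "nat \<Rightarrow> nat \<Rightarrow> real"
    and v :: "real \<Rightarrow> real"
  assumes "0 < \<beta>" and "\<beta> < 1"
    and "\<sigma> = 1 - \<beta> / 2"
    and "r \<ge> 1"
    and "T > 0"
    and "\<And>N. N \<ge> 1 \<Longrightarrow> mesh T N (t N)"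
    and "quasi_graded r t"
    and "\<mu> \<in> {0<..<1} \<union> {1<..<2}"
    and "continuous_on {0..T} v"
    and "Ck_on 3 v {0<..T}"
    and "\<And>l s. l \<le> 3 \<Longrightarrow> s \<in> {0<..T} \<Longrightarrow>
           \<bar>deriv_within l v {0<..T} s\<bar> \<le> C * (1 + s powr (\<mu> - real l))"
  shows "\<exists>C'>0. \<forall>N\<ge>1. \<forall>n\<in>{1..N}.
           \<bar>caputo \<beta> v (tstar \<sigma> (t N) n) - alikhanov \<beta> \<sigma> (t N) v n\<bar>
             \<le> C' * step (t N) 1 powr (\<mu> - \<beta>) *
               (step (t N) 1 / t N n) powr (min (1 + \<beta>) ((3 - \<beta>) / r - \<mu> + \<beta>))"
proof -
  obtain \<kappa> where \<kappa>: "1 \<le> \<kappa>"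
    "\<And>N n. 1 \<le> n \<Longrightarrow> n \<le> N \<Longrightarrow>
      step (t N) n \<le> \<kappa> * (t N 1 powr (1 / r) * t N n powr (1 - 1 / r))"
    "\<And>N n. 1 \<le> n \<Longrightarrow> n \<le> N \<Longrightarrow>
      t N 1 powr (1 / r) * t N n powr (1 - 1 / r) \<le> \<kappa> * step (t N) n"
    "\<And>N n. 1 \<le> n \<Longrightarrow> Suc n \<le> N \<Longrightarrow> t N (Suc n) \<le> \<kappa> * t N n"
    using quasi_graded_uniform[OF assms(7) _ assms(6)] assms(4) by auto
  define d where "d l = deriv_within l v {0<..T}" for l
  \<comment> \<open>One constant for both absorptions of the summand 1, at derivative orders 2 and
    3.\<close>
  define M where "M = max (T powr (2 - \<mu>)) (T powr (3 - \<mu>))"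
  define A where "A = \<bar>C\<bar> * (1 + M)"
  have M: "T powr (2 - \<mu>) \<le> M" "T powr (3 - \<mu>) \<le> M" by (auto simp: M_def)
  have d0: "d 0 = v" by (simp add: d_def)
  have regular: "weakly_singular v (d 1) (d 2) (d 3) T \<mu> A"
  proof
    show "0 < \<mu>" "\<mu> < 2" "\<mu> \<noteq> 1" using assms(8) by auto
    have "0 \<le> M" using M(1) powr_ge_zero order_trans by blast
    then show "0 \<le> A" by (simp add: A_def)
    show "continuous_on {0..T} v" by fact
    fix s assume s: "s \<in> {0<..<T}"
    show "(v has_real_derivative d 1 s) (at s)"
      using DERIV_deriv_within[OF assms(10) _ s, of 0] d0 by (simp add: d_def)
    show "(d 1 has_real_derivative d 2 s) (at s)" "(d 2 has_real_derivative d 3 s) (at s)"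
      using DERIV_deriv_within[OF assms(10) _ s, of 1] DERIV_deriv_within[OF assms(10) _ s, of 2]
      by (simp_all add: d_def numeral_2_eq_2 numeral_3_eq_3)
    have "\<bar>d 2 s\<bar> \<le> A * s powr (- (2 - \<mu>))"
      unfolding A_def using assms(11)[of 2 s] s M assms(8)
      by (intro absorb_constant[where T = T]) (auto simp: d_def)
    then show "\<bar>d 2 s\<bar> \<le> A * s powr (\<mu> - 2)" by simp
    have "\<bar>d 3 s\<bar> \<le> A * s powr (- (3 - \<mu>))"
      unfolding A_def using assms(11)[of 3 s] s M assms(8)
      by (intro absorb_constant[where T = T]) (auto simp: d_def)
    then show "\<bar>d 3 s\<bar> \<le> A * s powr (\<mu> - 3)" by simp
  qed
  let ?K = "consistency_const r \<kappa> \<beta> \<mu> A"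
  \<comment> \<open>Passing to \<open>\<bar>?K\<bar> + 1\<close> makes the final constant strictly
    positive, also when \<open>A = 0\<close>.\<close>
  have bound: "\<bar>caputo \<beta> v (tstar \<sigma> (t N) n) - alikhanov \<beta> \<sigma> (t N) v n\<bar>
      \<le> (\<bar>?K\<bar> + 1) * step (t N) 1 powr (\<mu> - \<beta>) *
        (step (t N) 1 / t N n) powr (min (1 + \<beta>) ((3 - \<beta>) / r - \<mu> + \<beta>))"
    if n: "1 \<le> N" "n \<in> {1..N}" for N n
  proof -
    interpret graded_mesh r \<kappa> T \<beta> N "t N"
      by unfold_locales (use assms \<kappa> n in auto)
    interpret weakly_singular v "d 1" "d 2" "d 3" T \<mu> A by (rule regular)
    interpret graded_mesh_function r \<kappa> T \<beta> N "t N" v "d 1" "d 2" "d 3" \<mu> A ..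
    have "\<bar>caputo \<beta> v (tstar \<sigma> (t N) n) - alikhanov \<beta> \<sigma> (t N) v n\<bar>
      \<le> ?K * t N 1 powr (\<mu> - \<beta>) * (t N 1 / t N n) powr (min (1 + \<beta>) ((3 - \<beta>) / r - \<mu> + \<beta>))"
    proof (cases "n = 1")
      case True
      then show ?thesis using error_first n x_pos[of 1] unfolding assms(3) by simp
    next
      case False
      then show ?thesis using error_later[of n] n unfolding assms(3) by simp
    qed
    also have "\<dots> \<le> (\<bar>?K\<bar> + 1) * t N 1 powr (\<mu> - \<beta>) *
        (t N 1 / t N n) powr (min (1 + \<beta>) ((3 - \<beta>) / r - \<mu> + \<beta>))"
      by (intro mult_right_mono) auto
    finally show ?thesis unfolding step_one .
  qed
  show ?thesis
    by (rule exI[of _ "\<bar>?K\<bar> + 1"]) (use bound in auto)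
qed

end
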